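(* Suppose that $D\subsetneq \mathbb{R}^n$ is a $\varphi$-uniform domain and $x_0\in D$. Let $\{x_i\}_{i=1}^{\infty}$ be a sequence of points in $B^n(x_0,\delta_D(x_0))$ satisfying $x_i\in[x_0,x_{i-1})$ (for $i\ge 2$) and $|x_0-x_i|=\frac{1}{2^{i+2}}\delta_D(x_0)$. Let $B_i$, $i=1,2,\ldots$, be disjoint balls with centers $x_i$ and radii $r_i$, and for a fixed $c\in(0,1)$ let $E_i\subset B^n(x_i,c r_i)$ be closed sets whose complements with respect to $\mathbb{R}^n$ are $\psi$-uniform and which satisfy $x_i\in E_i$. Denote $F=\bigcup_{i=1}^\infty E_i\cup\{x_0\}$. Then $D\setminus F$ is $\varphi_3$-uniform with $\varphi_3$ depending on $\varphi$ and $\psi$.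
   Context: Throughout $n\ge 2$; a domain is an open connected non-empty subset of $\mathbb{R}^n$. $B^n(x,r)$ is the open Euclidean ball with center $x$ and radius $r$; $[a,b)$ is the half-open Euclidean segment from $a$ to $b$ (containing $a$, not $b$). For a domain $G\subsetneq\mathbb{R}^n$ and $x\in G$, $\delta_G(x)$ is the Euclidean distance from $x$ to $\partial G$. The quasihyperbolic metric of $G$ is $k_G(x,y)=\inf_{\gamma}\int_\gamma \frac{|dz|}{\delta_G(z)}$, the infimum being over all rectifiable paths $\gamma\subset G$ joining $x$ and $y$. For a homeomorphism $\varphi:[0,\infty)\to[0,\infty)$, a domain $G\subsetneq\mathbb{R}^n$ is called $\varphi$-uniform if $k_G(x,y)\le \varphi\big(|x-y|/\min\{\delta_G(x),\delta_G(y)\}\big)$ for all $x,y\in G$ (and similarly for the homeomorphisms $\psi$, $\varphi_3$ of $[0,\infty)$). *)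

theory Defs
  imports "HOL-Analysis.Analysis"
begin

definition domain :: "'a::euclidean_space set \<Rightarrow> bool" where
  "domain G \<longleftrightarrow> open G \<and> connected G \<and> G \<noteq> {}"

definition bdist :: "'a::euclidean_space set \<Rightarrow> 'a \<Rightarrow> real" where
  "bdist G x = infdist x (frontier G)"

definition variation_sums :: "(real \<Rightarrow> 'a::euclidean_space) \<Rightarrow> real \<Rightarrow> real \<Rightarrow> real set" where
  "variation_sums \<gamma> a b =
     {\<Sum>i<m. dist (\<gamma> (t i)) (\<gamma> (t (Suc i))) | (m::nat) (t::nat \<Rightarrow> real).
        (\<forall>i\<le>m. t i \<in> {a..b}) \<and> (\<forall>i<m. t i \<le> t (Suc i))}"

definition arc_length :: "(real \<Rightarrow> 'a::euclidean_space) \<Rightarrow> real \<Rightarrow> real \<Rightarrow> real" where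
  "arc_length \<gamma> a b = Sup (variation_sums \<gamma> a b)"

definition rectifiable_path :: "(real \<Rightarrow> 'a::euclidean_space) \<Rightarrow> bool" where
  "rectifiable_path \<gamma> \<longleftrightarrow> path \<gamma> \<and> bdd_above (variation_sums \<gamma> 0 1)"

text \<open>Parametrization by arc length. The value does not depend on the chosen parameter, since
  a rectifiable path is constant on every interval on which its length function is constant.\<close>

definition arc_param :: "(real \<Rightarrow> 'a::euclidean_space) \<Rightarrow> real \<Rightarrow> 'a" where
  "arc_param \<gamma> s = \<gamma> (SOME t. t \<in> {0..1} \<and> arc_length \<gamma> 0 t = s)"

definition line_integral :: "('a::euclidean_space \<Rightarrow> real) \<Rightarrow> (real \<Rightarrow> 'a) \<Rightarrow> real" where
  "line_integral f \<gamma> = integral {0..arc_length \<gamma> 0 1} (\<lambda>s. f (arc_param \<gamma> s))"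

definition qh_metric :: "'a::euclidean_space set \<Rightarrow> 'a \<Rightarrow> 'a \<Rightarrow> real" where
  "qh_metric G x y =
     Inf {line_integral (\<lambda>z. 1 / bdist G z) \<gamma> | \<gamma>.
            rectifiable_path \<gamma> \<and> path_image \<gamma> \<subseteq> G \<and> pathstart \<gamma> = x \<and> pathfinish \<gamma> = y}"

definition halfline_homeo :: "(real \<Rightarrow> real) \<Rightarrow> bool" where
  "halfline_homeo \<phi> \<longleftrightarrow> (\<exists>\<theta>. homeomorphism {0..} {0..} \<phi> \<theta>)"

definition uniform_domain :: "(real \<Rightarrow> real) \<Rightarrow> 'a::euclidean_space set \<Rightarrow> bool" where
  "uniform_domain \<phi> G \<longleftrightarrow> domain G \<and> G \<noteq> UNIV \<and>
     (\<forall>x\<in>G. \<forall>y\<in>G. qh_metric G x y \<le> \<phi> (dist x y / min (bdist G x) (bdist G y)))"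

definition half_open_segment :: "'a::euclidean_space \<Rightarrow> 'a \<Rightarrow> 'a set" where
  "half_open_segment a b = closed_segment a b - {b}"

end

theory Submission
  imports Defs
begin

text \<open>
  Up to constants, \<open>k\<^sub>G(x, y)\<close> is the least number of steps in a chain from \<open>x\<close> to \<open>y\<close> in which each
  step is at most half the distance of its endpoints to the complement of \<open>G\<close>.  So \<open>\<phi>\<close>-uniformity for
  some \<open>\<phi>\<close> means that the length of the chains is controlled by \<open>|x - y| / min (\<delta>\<^sub>G(x), \<delta>\<^sub>G(y))\<close>; small
  values of this ratio are handled by segments.

  Chains survive the removal of sets \<open>E\<^sub>i\<close> lying well inside separated balls \<open>H\<^sub>i\<close>.  A chain of \<open>D\<close>
  between points outside the \<open>H\<^sub>i\<close> is pushed to the spheres bounding the \<open>H\<^sub>i\<close>; a step inside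
  \<open>H\<^sub>i\<close> is replaced by a bounded number of steps along the sphere, which is connected since \<open>n \<ge> 2\<close>.  In
  the same way a chain of the complement of \<open>E\<^sub>i\<close> is pushed into \<open>H\<^sub>i\<close>.  Points inside and outside are
  linked through the point where the segment between them leaves \<open>H\<^sub>i\<close>.  This is applied first to the
  set \<open>{x\<^sub>0}\<close>, and then in \<open>D - {x\<^sub>0}\<close> to the sets \<open>E\<^sub>i\<close> with balls about \<open>x\<^sub>i\<close> of radius
  \<open>c r\<^sub>i + \<epsilon> |x\<^sub>i - x\<^sub>0|\<close>.  They are comparable in size to \<open>|x\<^sub>i - x\<^sub>0|\<close> even if \<open>r\<^sub>i\<close> is tiny, and disjointness
  of the \<open>B\<^sub>i\<close> separates them if \<open>\<epsilon>\<close> is small compared with \<open>1 - c\<close>.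
\<close>

section \<open>Arc length\<close>

lemma variation_sumsI:
  assumes "\<And>i. i \<le> m \<Longrightarrow> t i \<in> {a..b}" "\<And>i. i < m \<Longrightarrow> t i \<le> t (Suc i)"
  shows "(\<Sum>i<m. dist (\<gamma> (t i)) (\<gamma> (t (Suc i)))) \<in> variation_sums \<gamma> a b"
  unfolding variation_sums_def using assms by blast

lemma variation_sumsE:
  assumes "v \<in> variation_sums \<gamma> a b"
  obtains m t where "v = (\<Sum>i<m. dist (\<gamma> (t i)) (\<gamma> (t (Suc i))))"
    "\<And>i. i \<le> m \<Longrightarrow> t i \<in> {a..b}" "\<And>i. i < m \<Longrightarrow> t i \<le> t (Suc i)"
  using assms unfolding variation_sums_def by blast

lemma variation_sums_nonempty:
  assumes "a \<le> b" shows "variation_sums \<gamma> a b \<noteq> {}"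
  using variation_sumsI[of 0 "\<lambda>_. a" a b \<gamma>] assms by auto

lemma variation_sums_reparam:
  assumes "mono_on {a..b} h" "h ` {a..b} \<subseteq> {a'..b'}" "\<And>x. x \<in> {a..b} \<Longrightarrow> \<gamma> x = \<gamma>' (h x)"
  shows "variation_sums \<gamma> a b \<subseteq> variation_sums \<gamma>' a' b'"
proof
  fix v assume "v \<in> variation_sums \<gamma> a b"
  then obtain m t where v_eq: "v = (\<Sum>i<m. dist (\<gamma> (t i)) (\<gamma> (t (Suc i))))"
    and partition: "\<And>i. i \<le> m \<Longrightarrow> t i \<in> {a..b}" "\<And>i. i < m \<Longrightarrow> t i \<le> t (Suc i)"
    by (rule variation_sumsE) blast
  have "v = (\<Sum>i<m. dist (\<gamma>' (h (t i))) (\<gamma>' (h (t (Suc i)))))"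
    unfolding v_eq using partition(1) assms(3) by (intro sum.cong) auto
  also have "\<dots> \<in> variation_sums \<gamma>' a' b'"
  proof (rule variation_sumsI)
    show "h (t i) \<in> {a'..b'}" if "i \<le> m" for i using partition(1)[OF that] assms(2) by blast
    show "h (t i) \<le> h (t (Suc i))" if "i < m" for i
      using that by (intro mono_onD[OF assms(1)] partition) auto
  qed
  finally show "v \<in> variation_sums \<gamma>' a' b'" .
qed

lemma variation_sums_mono:
  assumes "a' \<le> a" "b \<le> b'"
  shows "variation_sums \<gamma> a b \<subseteq> variation_sums \<gamma> a' b'"
  by (rule variation_sums_reparam[where h = "\<lambda>x. x"]) (use assms in \<open>auto intro: mono_onI\<close>)

lemma dist_split_min_max:
  fixes \<gamma> :: "real \<Rightarrow> 'a::metric_space"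
  assumes "x \<le> y"
  shows "dist (\<gamma> x) (\<gamma> y) \<le> dist (\<gamma> (min x b)) (\<gamma> (min y b)) + dist (\<gamma> (max x b)) (\<gamma> (max y b))"
proof -
  consider "y \<le> b" | "x \<le> b" "b \<le> y" | "b \<le> x" by linarith
  then show ?thesis
  proof cases
    case 2 then show ?thesis using dist_triangle[of "\<gamma> x" "\<gamma> y" "\<gamma> b"]
      by (auto simp: min_def max_def)
  qed (use assms in \<open>auto simp: min_def max_def\<close>)
qed

lemma variation_sums_subadditive:
  assumes "v \<in> variation_sums \<gamma> a c" "a \<le> b" "b \<le> c"
  obtains v1 v2 where "v1 \<in> variation_sums \<gamma> a b" "v2 \<in> variation_sums \<gamma> b c" "v \<le> v1 + v2"
proof -
  obtain m t where v_eq: "v = (\<Sum>i<m. dist (\<gamma> (t i)) (\<gamma> (t (Suc i))))"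
    and partition: "\<And>i. i \<le> m \<Longrightarrow> t i \<in> {a..c}" "\<And>i. i < m \<Longrightarrow> t i \<le> t (Suc i)"
    using assms(1) by (rule variation_sumsE) blast
  show thesis
  proof
    show "(\<Sum>i<m. dist (\<gamma> (min (t i) b)) (\<gamma> (min (t (Suc i)) b))) \<in> variation_sums \<gamma> a b"
      by (rule variation_sumsI)
        (use partition assms in \<open>auto simp: min_le_iff_disj intro: order_trans[OF partition(2)]\<close>)
    show "(\<Sum>i<m. dist (\<gamma> (max (t i) b)) (\<gamma> (max (t (Suc i)) b))) \<in> variation_sums \<gamma> b c"
      by (rule variation_sumsI)
        (use partition assms in \<open>auto simp: le_max_iff_disj intro: order_trans[OF _ partition(2)]\<close>)
    show "v \<le> (\<Sum>i<m. dist (\<gamma> (min (t i) b)) (\<gamma> (min (t (Suc i)) b))) +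
        (\<Sum>i<m. dist (\<gamma> (max (t i) b)) (\<gamma> (max (t (Suc i)) b)))"
      unfolding v_eq sum.distrib[symmetric] using partition(2)
      by (intro sum_mono dist_split_min_max) auto
  qed
qed

lemma sum_lessThan_add: "sum f {..<m + n} = sum f {..<m} + (\<Sum>i<n. f (m + i))"
  for f :: "nat \<Rightarrow> 'a::comm_monoid_add"
  by (induction n) (simp_all add: add.assoc)

lemma variation_sums_superadditive:
  assumes "v1 \<in> variation_sums \<gamma> a b" "v2 \<in> variation_sums \<gamma> b c" "a \<le> b" "b \<le> c"
  obtains v where "v \<in> variation_sums \<gamma> a c" "v1 + v2 \<le> v"
proof -
  obtain m t where v1_eq: "v1 = (\<Sum>i<m. dist (\<gamma> (t i)) (\<gamma> (t (Suc i))))"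
    and t_partition: "\<And>i. i \<le> m \<Longrightarrow> t i \<in> {a..b}" "\<And>i. i < m \<Longrightarrow> t i \<le> t (Suc i)"
    using assms(1) by (rule variation_sumsE) blast
  obtain k u where v2_eq: "v2 = (\<Sum>i<k. dist (\<gamma> (u i)) (\<gamma> (u (Suc i))))"
    and u_partition: "\<And>i. i \<le> k \<Longrightarrow> u i \<in> {b..c}" "\<And>i. i < k \<Longrightarrow> u i \<le> u (Suc i)"
    using assms(2) by (rule variation_sumsE) blast
  define w where "w i = (if i \<le> m then t i else u (i - Suc m))" for i
  let ?v = "\<Sum>i<Suc m + k. dist (\<gamma> (w i)) (\<gamma> (w (Suc i)))"
  show thesis
  proof
    show "?v \<in> variation_sums \<gamma> a c"
    proof (rule variation_sumsI)
      show "w i \<in> {a..c}" if "i \<le> Suc m + k" for i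
        using that t_partition(1)[of i] u_partition(1)[of "i - Suc m"] assms(3,4)
        by (cases "i \<le> m") (auto simp: w_def le_diff_conv add.commute)
      show "w i \<le> w (Suc i)" if i_less: "i < Suc m + k" for i
      proof (cases i m rule: linorder_cases)
        case equal
        then show ?thesis using t_partition(1)[of m] u_partition(1)[of 0] unfolding w_def by auto
      next
        case greater
        then obtain j where "i = Suc (m + j)" using less_imp_Suc_add by blast
        then show ?thesis using u_partition(2)[of j] i_less unfolding w_def by simp
      qed (use t_partition(2) in \<open>auto simp: w_def\<close>)
    qed
    have "?v = (\<Sum>i<m. dist (\<gamma> (w i)) (\<gamma> (w (Suc i)))) + dist (\<gamma> (w m)) (\<gamma> (w (Suc m))) +
       (\<Sum>i<k. dist (\<gamma> (w (Suc m + i))) (\<gamma> (w (Suc (Suc m + i)))))"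
      unfolding sum_lessThan_add by simp
    moreover have "(\<Sum>i<m. dist (\<gamma> (w i)) (\<gamma> (w (Suc i)))) = v1"
      unfolding v1_eq by (intro sum.cong) (auto simp: w_def)
    moreover have "(\<Sum>i<k. dist (\<gamma> (w (Suc m + i))) (\<gamma> (w (Suc (Suc m + i))))) = v2"
      unfolding v2_eq by (intro sum.cong) (auto simp: w_def)
    ultimately show "v1 + v2 \<le> ?v" by simp
  qed
qed

lemma variation_sum_le_arc_length:
  assumes "bdd_above (variation_sums \<gamma> a b)" "v \<in> variation_sums \<gamma> a b"
  shows "v \<le> arc_length \<gamma> a b"
  unfolding arc_length_def using assms by (rule cSup_upper[rotated])

lemma arc_length_least:
  assumes "a \<le> b" "\<And>v. v \<in> variation_sums \<gamma> a b \<Longrightarrow> v \<le> L"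
  shows "arc_length \<gamma> a b \<le> L"
  unfolding arc_length_def using variation_sums_nonempty[OF assms(1)] assms(2) by (rule cSup_least)

lemma arc_length_add:
  assumes bdd: "bdd_above (variation_sums \<gamma> a c)" and ordered: "a \<le> b" "b \<le> c"
  shows "arc_length \<gamma> a c = arc_length \<gamma> a b + arc_length \<gamma> b c"
proof (rule antisym)
  have "bdd_above (variation_sums \<gamma> a b)" "bdd_above (variation_sums \<gamma> b c)"
    using bdd variation_sums_mono ordered by (meson bdd_above_mono order_refl)+
  note upper = this[THEN variation_sum_le_arc_length]
  show "arc_length \<gamma> a c \<le> arc_length \<gamma> a b + arc_length \<gamma> b c"
  proof (rule arc_length_least)
    fix v assume "v \<in> variation_sums \<gamma> a c"
    then obtain v1 v2 where "v1 \<in> variation_sums \<gamma> a b" "v2 \<in> variation_sums \<gamma> b c" "v \<le> v1 + v2"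
      using variation_sums_subadditive ordered by blast
    then show "v \<le> arc_length \<gamma> a b + arc_length \<gamma> b c" using upper by force
  qed (use ordered in simp)
  have "v1 + v2 \<le> arc_length \<gamma> a c"
    if v1_v2: "v1 \<in> variation_sums \<gamma> a b" "v2 \<in> variation_sums \<gamma> b c" for v1 v2
  proof -
    obtain v where "v \<in> variation_sums \<gamma> a c" "v1 + v2 \<le> v"
      using v1_v2 ordered by (rule variation_sums_superadditive)
    then show ?thesis using variation_sum_le_arc_length[OF bdd] by force
  qed
  then have "v1 \<le> arc_length \<gamma> a c - arc_length \<gamma> b c" if "v1 \<in> variation_sums \<gamma> a b" for v1
    using that arc_length_least[OF ordered(2), of \<gamma> "arc_length \<gamma> a c - v1"] by fastforce
  then show "arc_length \<gamma> a b + arc_length \<gamma> b c \<le> arc_length \<gamma> a c"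
    using arc_length_least[OF ordered(1), of \<gamma> "arc_length \<gamma> a c - arc_length \<gamma> b c"] by simp
qed

lemma dist_le_arc_length:
  assumes bdd: "bdd_above (variation_sums \<gamma> a b)" and ordered: "a \<le> b"
  shows "dist (\<gamma> a) (\<gamma> b) \<le> arc_length \<gamma> a b"
  using variation_sum_le_arc_length[OF bdd] ordered
    variation_sumsI[of 1 "\<lambda>i. if i = 0 then a else b" a b \<gamma>] by simp

lemma arc_length_same [simp]: "arc_length \<gamma> a a = 0"
proof (rule antisym)
  have zero: "v = 0" if v_in: "v \<in> variation_sums \<gamma> a a" for v
  proof -
    obtain m t where "v = (\<Sum>i<m. dist (\<gamma> (t i)) (\<gamma> (t (Suc i))))" "\<And>i. i \<le> m \<Longrightarrow> t i = a"
      using v_in by (rule variation_sumsE) auto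
    then show ?thesis by simp
  qed
  show "arc_length \<gamma> a a \<le> 0" by (rule arc_length_least) (use zero in force)+
  have "bdd_above (variation_sums \<gamma> a a)" using zero by (intro bdd_aboveI[of _ 0]) force
  from dist_le_arc_length[OF this] show "0 \<le> arc_length \<gamma> a a" by simp
qed

lemma rectifiable_path_bdd_above:
  assumes "rectifiable_path \<gamma>" "0 \<le> a" "b \<le> 1"
  shows "bdd_above (variation_sums \<gamma> a b)"
  using assms variation_sums_mono unfolding rectifiable_path_def by (meson bdd_above_mono)

lemma arc_length_nonneg:
  assumes "rectifiable_path \<gamma>" "0 \<le> a" "a \<le> b" "b \<le> 1"
  shows "0 \<le> arc_length \<gamma> a b"
  using dist_le_arc_length[OF rectifiable_path_bdd_above[OF assms(1,2,4)] assms(3)]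
  by (rule order_trans[OF zero_le_dist])

lemma abs_arc_length_diff:
  assumes "rectifiable_path \<gamma>" "x \<in> {0..1}" "y \<in> {0..1}"
  shows "\<bar>arc_length \<gamma> 0 x - arc_length \<gamma> 0 y\<bar> = arc_length \<gamma> (min x y) (max x y)"
proof -
  have "\<bar>arc_length \<gamma> 0 a - arc_length \<gamma> 0 b\<bar> = arc_length \<gamma> a b" if "0 \<le> a" "a \<le> b" "b \<le> 1" for a b
    using arc_length_add[OF rectifiable_path_bdd_above[OF assms(1)], of 0 b a]
      arc_length_nonneg[OF assms(1) that] that by simp
  from this[of x y] this[of y x] show ?thesis
    using assms(2,3) by (auto simp: min_def max_def abs_minus_commute)
qed

lemma dist_le_abs_arc_length_diff:
  assumes "rectifiable_path \<gamma>" "x \<in> {0..1}" "y \<in> {0..1}"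
  shows "dist (\<gamma> x) (\<gamma> y) \<le> \<bar>arc_length \<gamma> 0 x - arc_length \<gamma> 0 y\<bar>"
  unfolding abs_arc_length_diff[OF assms]
  using dist_le_arc_length[OF rectifiable_path_bdd_above[OF assms(1)], of "min x y" "max x y"] assms(2,3)
  by (auto simp: min_def max_def dist_commute split: if_splits)

lemma variation_sum_le_oscillation:
  assumes rect: "rectifiable_path \<gamma>" and bounds: "0 \<le> a" "a \<le> b" "b \<le> 1"
    and partition: "\<And>i. i \<le> m \<Longrightarrow> t i \<in> {0..1}" "\<And>i. i < m \<Longrightarrow> t i \<le> t (Suc i)"
    and oscillation: "\<And>x y. x \<in> {a..b} \<Longrightarrow> y \<in> {a..b} \<Longrightarrow> dist (\<gamma> x) (\<gamma> y) \<le> e"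
  shows "(\<Sum>i<m. dist (\<gamma> (t i)) (\<gamma> (t (Suc i)))) \<le> arc_length \<gamma> 0 a + (real m * e + arc_length \<gamma> b 1)"
proof -
  define before where "before i = min (t i) a" for i
  define after where "after i = max (max (t i) a) b" for i
  define clamped where "clamped i = min (max (t i) a) b" for i
  have "dist (\<gamma> (t i)) (\<gamma> (t (Suc i))) \<le> dist (\<gamma> (before i)) (\<gamma> (before (Suc i))) +
      (dist (\<gamma> (clamped i)) (\<gamma> (clamped (Suc i))) + dist (\<gamma> (after i)) (\<gamma> (after (Suc i))))"
    if "i < m" for i
    using dist_split_min_max[OF partition(2)[OF that], of \<gamma> a]
      dist_split_min_max[of "max (t i) a" "max (t (Suc i)) a" \<gamma> b] partition(2)[OF that]
    unfolding before_def after_def clamped_def by (simp add: max.coboundedI1)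
  then have "(\<Sum>i<m. dist (\<gamma> (t i)) (\<gamma> (t (Suc i)))) \<le> (\<Sum>i<m. dist (\<gamma> (before i)) (\<gamma> (before (Suc i)))) +
      ((\<Sum>i<m. dist (\<gamma> (clamped i)) (\<gamma> (clamped (Suc i)))) +
       (\<Sum>i<m. dist (\<gamma> (after i)) (\<gamma> (after (Suc i)))))"
    unfolding sum.distrib[symmetric] by (intro sum_mono) simp
  also have "\<dots> \<le> arc_length \<gamma> 0 a + (real m * e + arc_length \<gamma> b 1)"
  proof (intro add_mono)
    show "(\<Sum>i<m. dist (\<gamma> (before i)) (\<gamma> (before (Suc i)))) \<le> arc_length \<gamma> 0 a"
      by (rule variation_sum_le_arc_length[OF rectifiable_path_bdd_above[OF rect] variation_sumsI])
        (use bounds partition in \<open>auto simp: before_def min_le_iff_disj\<close>)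
    have "after i \<le> after (Suc i)" if "i < m" for i
      unfolding after_def using partition(2)[OF that] by (intro max.mono) auto
    then show "(\<Sum>i<m. dist (\<gamma> (after i)) (\<gamma> (after (Suc i)))) \<le> arc_length \<gamma> b 1"
      using bounds partition(1)
      by (intro variation_sum_le_arc_length[OF rectifiable_path_bdd_above[OF rect] variation_sumsI])
        (auto simp: after_def)
    have "(\<Sum>i<m. dist (\<gamma> (clamped i)) (\<gamma> (clamped (Suc i)))) \<le> (\<Sum>i<m. e)"
      using bounds by (intro sum_mono oscillation) (auto simp: clamped_def)
    then show "(\<Sum>i<m. dist (\<gamma> (clamped i)) (\<gamma> (clamped (Suc i)))) \<le> real m * e" by simp
  qed
  finally show ?thesis .
qed

lemma arc_length_uniformly_small:
  assumes rect: "rectifiable_path \<gamma>" and "0 < e"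
  obtains d where "0 < d"
    "\<And>a b. 0 \<le> a \<Longrightarrow> a \<le> b \<Longrightarrow> b \<le> 1 \<Longrightarrow> b - a < d \<Longrightarrow> arc_length \<gamma> a b < e"
proof -
  note bdd = rectifiable_path_bdd_above[OF rect]
  obtain v where v_in: "v \<in> variation_sums \<gamma> 0 1" and v_gt: "arc_length \<gamma> 0 1 - e/2 < v"
    using less_cSup_iff[OF variation_sums_nonempty bdd, of 0 1 "arc_length \<gamma> 0 1 - e/2"] \<open>0 < e\<close>
    unfolding arc_length_def by auto
  obtain m t where v_eq: "v = (\<Sum>i<m. dist (\<gamma> (t i)) (\<gamma> (t (Suc i))))"
    and partition: "\<And>i. i \<le> m \<Longrightarrow> t i \<in> {0..1}" "\<And>i. i < m \<Longrightarrow> t i \<le> t (Suc i)"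
    using v_in by (rule variation_sumsE) blast
  define e' where "e' = e / (2 * (real m + 1))"
  have e'_bounds: "0 < e'" "real m * e' < e/2"
    using \<open>0 < e\<close> unfolding e'_def by (auto simp: field_simps)
  have "uniformly_continuous_on {0..1} \<gamma>"
    using rect unfolding rectifiable_path_def path_def by (simp add: compact_uniformly_continuous)
  then obtain d where modulus: "0 < d"
    "\<And>x y. x \<in> {0..1} \<Longrightarrow> y \<in> {0..1} \<Longrightarrow> dist y x < d \<Longrightarrow> dist (\<gamma> y) (\<gamma> x) < e'"
    using e'_bounds(1) unfolding uniformly_continuous_on_def by meson
  show thesis
  proof
    fix a b :: real assume bounds: "0 \<le> a" "a \<le> b" "b \<le> 1" "b - a < d"
    have "v \<le> arc_length \<gamma> 0 a + (real m * e' + arc_length \<gamma> b 1)"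
      unfolding v_eq
    proof (rule variation_sum_le_oscillation[OF rect bounds(1-3)])
      show "dist (\<gamma> x) (\<gamma> y) \<le> e'" if "x \<in> {a..b}" "y \<in> {a..b}" for x y
        using that bounds by (intro less_imp_le modulus(2)) (auto simp: dist_real_def)
    qed (use partition in auto)
    moreover have "arc_length \<gamma> 0 1 = arc_length \<gamma> 0 a + arc_length \<gamma> a b + arc_length \<gamma> b 1"
      using arc_length_add[OF bdd, of 0 1 a] arc_length_add[OF bdd, of a 1 b] bounds by auto
    ultimately show "arc_length \<gamma> a b < e" using v_gt e'_bounds(2) by linarith
  qed (rule modulus(1))
qed

lemma arc_length_continuous:
  assumes "rectifiable_path \<gamma>"
  shows "continuous_on {0..1} (arc_length \<gamma> 0)"
  unfolding continuous_on_iff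
proof (intro ballI allI impI)
  fix x e :: real assume "x \<in> {0..1}" and "0 < e"
  obtain d where modulus: "0 < d"
    "\<And>a b. 0 \<le> a \<Longrightarrow> a \<le> b \<Longrightarrow> b \<le> 1 \<Longrightarrow> b - a < d \<Longrightarrow> arc_length \<gamma> a b < e"
    using arc_length_uniformly_small[OF assms \<open>0 < e\<close>] by blast
  have "dist (arc_length \<gamma> 0 y) (arc_length \<gamma> 0 x) < e" if "y \<in> {0..1}" "dist y x < d" for y
    unfolding dist_real_def abs_arc_length_diff[OF assms that(1) \<open>x \<in> {0..1}\<close>]
    using that \<open>x \<in> {0..1}\<close> by (intro modulus(2)) (auto simp: dist_real_def)
  then show "\<exists>d>0. \<forall>y\<in>{0..1}. dist y x < d \<longrightarrow> dist (arc_length \<gamma> 0 y) (arc_length \<gamma> 0 x) < e"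
    using modulus(1) by blast
qed

lemma arc_length_surj:
  assumes "rectifiable_path \<gamma>" "s \<in> {0..arc_length \<gamma> 0 1}"
  obtains t where "t \<in> {0..1}" "arc_length \<gamma> 0 t = s"
  using IVT'[of "arc_length \<gamma> 0" 0 s 1] arc_length_continuous[OF assms(1)] assms(2) that by auto

lemma arc_param_arc_length:
  assumes "rectifiable_path \<gamma>" "t \<in> {0..1}"
  shows "arc_param \<gamma> (arc_length \<gamma> 0 t) = \<gamma> t"
proof -
  define u where "u = (SOME u. u \<in> {0..1} \<and> arc_length \<gamma> 0 u = arc_length \<gamma> 0 t)"
  have "u \<in> {0..1} \<and> arc_length \<gamma> 0 u = arc_length \<gamma> 0 t"
    unfolding u_def by (rule someI[of _ t]) (use assms in auto)
  then have "\<gamma> u = \<gamma> t" using dist_le_abs_arc_length_diff[OF assms(1), of u t] assms(2) by simp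
  then show ?thesis unfolding arc_param_def u_def .
qed

lemma arc_param_in_path_image:
  assumes "rectifiable_path \<gamma>" "s \<in> {0..arc_length \<gamma> 0 1}"
  shows "arc_param \<gamma> s \<in> path_image \<gamma>"
  using arc_length_surj[OF assms] arc_param_arc_length[OF assms(1)] unfolding path_image_def
  by (metis imageI)

lemma arc_param_lipschitz:
  assumes "rectifiable_path \<gamma>"
  shows "1-lipschitz_on {0..arc_length \<gamma> 0 1} (arc_param \<gamma>)"
proof (rule lipschitz_onI)
  fix s s' assume "s \<in> {0..arc_length \<gamma> 0 1}" "s' \<in> {0..arc_length \<gamma> 0 1}"
  then obtain t u where "t \<in> {0..1}" "arc_length \<gamma> 0 t = s" "u \<in> {0..1}" "arc_length \<gamma> 0 u = s'"
    using arc_length_surj[OF assms] by metis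
  then show "dist (arc_param \<gamma> s) (arc_param \<gamma> s') \<le> 1 * dist s s'"
    using dist_le_abs_arc_length_diff[OF assms, of t u] arc_param_arc_length[OF assms]
    by (auto simp: dist_real_def)
qed simp

lemma arc_param_integrable:
  fixes f :: "'a::euclidean_space \<Rightarrow> real"
  assumes "rectifiable_path \<gamma>" "path_image \<gamma> \<subseteq> G" "continuous_on G f"
  shows "(\<lambda>s. f (arc_param \<gamma> s)) integrable_on {0..arc_length \<gamma> 0 1}"
proof (rule integrable_continuous_real, rule continuous_on_compose2[OF assms(3)])
  show "continuous_on {0..arc_length \<gamma> 0 1} (arc_param \<gamma>)"
    using arc_param_lipschitz[OF assms(1)] by (rule lipschitz_on_continuous_on)
  show "arc_param \<gamma> ` {0..arc_length \<gamma> 0 1} \<subseteq> G"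
    using arc_param_in_path_image[OF assms(1)] assms(2) by blast
qed

lemma line_integral_cong:
  assumes "rectifiable_path \<gamma>" "\<And>z. z \<in> path_image \<gamma> \<Longrightarrow> f z = g z"
  shows "line_integral f \<gamma> = line_integral g \<gamma>"
  unfolding line_integral_def
  by (intro integral_cong assms(2) arc_param_in_path_image[OF assms(1)])

lemma line_integral_le:
  fixes f :: "'a::euclidean_space \<Rightarrow> real"
  assumes "rectifiable_path \<gamma>" "path_image \<gamma> \<subseteq> G" "continuous_on G f"
    and "\<And>z. z \<in> path_image \<gamma> \<Longrightarrow> f z \<le> C"
  shows "line_integral f \<gamma> \<le> C * arc_length \<gamma> 0 1"
proof -
  have "line_integral f \<gamma> \<le> integral {0..arc_length \<gamma> 0 1} (\<lambda>s. C)"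
    unfolding line_integral_def
    using arc_param_integrable[OF assms(1-3)] arc_param_in_path_image[OF assms(1)] assms(4)
    by (intro integral_le) auto
  also have "\<dots> = C * arc_length \<gamma> 0 1"
    using arc_length_nonneg[OF assms(1), of 0 1] by simp
  finally show ?thesis .
qed

lemma variation_sums_linepath_le:
  assumes "v \<in> variation_sums (linepath x y) 0 1"
  shows "v \<le> dist x y"
proof -
  obtain m t where v_eq: "v = (\<Sum>i<m. dist (linepath x y (t i)) (linepath x y (t (Suc i))))"
    and partition: "\<And>i. i \<le> m \<Longrightarrow> t i \<in> {0..1}" "\<And>i. i < m \<Longrightarrow> t i \<le> t (Suc i)"
    using assms by (rule variation_sumsE) blast
  have "dist (linepath x y a) (linepath x y b) = (b - a) * dist x y" if "a \<le> b" for a b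
  proof -
    have "linepath x y a - linepath x y b = (b - a) *\<^sub>R (x - y)"
      by (simp add: linepath_def algebra_simps)
    then show ?thesis using that by (simp add: dist_norm)
  qed
  then have "v = (\<Sum>i<m. (t (Suc i) - t i) * dist x y)"
    unfolding v_eq using partition(2) by (intro sum.cong) auto
  also have "\<dots> = (t m - t 0) * dist x y"
    unfolding sum_distrib_right[symmetric] by (simp add: sum_lessThan_telescope)
  also have "\<dots> \<le> 1 * dist x y"
    using partition(1)[of m] partition(1)[of 0] by (intro mult_right_mono) auto
  finally show ?thesis by simp
qed

lemma rectifiable_linepath: "rectifiable_path (linepath x y)"
  unfolding rectifiable_path_def using variation_sums_linepath_le[of _ x y]
  by (auto intro!: bdd_aboveI[of _ "dist x y"])

lemma arc_length_linepath_le: "arc_length (linepath x y) 0 1 \<le> dist x y"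
  by (rule arc_length_least) (simp_all add: variation_sums_linepath_le)

lemma joinpaths_first_half:
  assumes "t \<in> {0..1}" shows "(\<gamma>\<^sub>1 +++ \<gamma>\<^sub>2) (t/2) = \<gamma>\<^sub>1 t"
  using assms by (simp add: joinpaths_def)

lemma joinpaths_second_half:
  assumes "pathfinish \<gamma>\<^sub>1 = pathstart \<gamma>\<^sub>2" "t \<in> {0..1}" shows "(\<gamma>\<^sub>1 +++ \<gamma>\<^sub>2) ((t+1)/2) = \<gamma>\<^sub>2 t"
  using assms by (cases "t = 0") (auto simp: joinpaths_def pathstart_def pathfinish_def field_simps)

lemma variation_sums_join_first:
  assumes "t \<in> {0..1}"
  shows "variation_sums (\<gamma>\<^sub>1 +++ \<gamma>\<^sub>2) 0 (t/2) = variation_sums \<gamma>\<^sub>1 0 t"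
proof
  show "variation_sums (\<gamma>\<^sub>1 +++ \<gamma>\<^sub>2) 0 (t/2) \<subseteq> variation_sums \<gamma>\<^sub>1 0 t"
    by (rule variation_sums_reparam[where h = "\<lambda>x. 2*x"])
      (use assms in \<open>auto intro!: mono_onI simp: joinpaths_def\<close>)
  show "variation_sums \<gamma>\<^sub>1 0 t \<subseteq> variation_sums (\<gamma>\<^sub>1 +++ \<gamma>\<^sub>2) 0 (t/2)"
    by (rule variation_sums_reparam[where h = "\<lambda>x. x/2"])
      (use assms in \<open>auto intro!: mono_onI simp: joinpaths_first_half\<close>)
qed

lemma variation_sums_join_second:
  assumes "pathfinish \<gamma>\<^sub>1 = pathstart \<gamma>\<^sub>2" "t \<in> {0..1}"
  shows "variation_sums (\<gamma>\<^sub>1 +++ \<gamma>\<^sub>2) (1/2) ((t+1)/2) = variation_sums \<gamma>\<^sub>2 0 t"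
proof
  show "variation_sums (\<gamma>\<^sub>1 +++ \<gamma>\<^sub>2) (1/2) ((t+1)/2) \<subseteq> variation_sums \<gamma>\<^sub>2 0 t"
  proof (rule variation_sums_reparam[where h = "\<lambda>x. 2*x-1"])
    fix x assume "x \<in> {1/2..(t+1)/2}"
    then show "(\<gamma>\<^sub>1 +++ \<gamma>\<^sub>2) x = \<gamma>\<^sub>2 (2*x-1)"
      using joinpaths_second_half[OF assms(1), of "2*x-1"] assms(2) by auto
  qed (auto intro!: mono_onI)
  show "variation_sums \<gamma>\<^sub>2 0 t \<subseteq> variation_sums (\<gamma>\<^sub>1 +++ \<gamma>\<^sub>2) (1/2) ((t+1)/2)"
    by (rule variation_sums_reparam[where h = "\<lambda>x. (x+1)/2"])
      (use assms in \<open>auto intro!: mono_onI simp: joinpaths_second_half\<close>)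
qed

lemma rectifiable_path_join:
  assumes "rectifiable_path \<gamma>\<^sub>1" "rectifiable_path \<gamma>\<^sub>2" "pathfinish \<gamma>\<^sub>1 = pathstart \<gamma>\<^sub>2"
  shows "rectifiable_path (\<gamma>\<^sub>1 +++ \<gamma>\<^sub>2)"
proof -
  let ?\<gamma> = "\<gamma>\<^sub>1 +++ \<gamma>\<^sub>2"
  have "bdd_above (variation_sums ?\<gamma> 0 (1/2))" "bdd_above (variation_sums ?\<gamma> (1/2) 1)"
    using variation_sums_join_first[of 1 \<gamma>\<^sub>1 \<gamma>\<^sub>2] variation_sums_join_second[OF assms(3), of 1] assms(1,2)
    unfolding rectifiable_path_def by auto
  note upper = this[THEN variation_sum_le_arc_length]
  have "bdd_above (variation_sums ?\<gamma> 0 1)"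
  proof (rule bdd_aboveI)
    fix v assume "v \<in> variation_sums ?\<gamma> 0 1"
    then obtain v1 v2 where "v1 \<in> variation_sums ?\<gamma> 0 (1/2)" "v2 \<in> variation_sums ?\<gamma> (1/2) 1"
      "v \<le> v1 + v2"
      using variation_sums_subadditive[of v ?\<gamma> 0 1 "1/2"] by auto
    then show "v \<le> arc_length ?\<gamma> 0 (1/2) + arc_length ?\<gamma> (1/2) 1" using upper by force
  qed
  then show ?thesis using assms unfolding rectifiable_path_def by auto
qed

lemma arc_length_join_first:
  assumes "t \<in> {0..1}" shows "arc_length (\<gamma>\<^sub>1 +++ \<gamma>\<^sub>2) 0 (t/2) = arc_length \<gamma>\<^sub>1 0 t"
  unfolding arc_length_def variation_sums_join_first[OF assms] ..

lemma arc_length_join_second: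
  assumes "rectifiable_path \<gamma>\<^sub>1" "rectifiable_path \<gamma>\<^sub>2" "pathfinish \<gamma>\<^sub>1 = pathstart \<gamma>\<^sub>2" "t \<in> {0..1}"
  shows "arc_length (\<gamma>\<^sub>1 +++ \<gamma>\<^sub>2) 0 ((t+1)/2) = arc_length \<gamma>\<^sub>1 0 1 + arc_length \<gamma>\<^sub>2 0 t"
proof -
  let ?\<gamma> = "\<gamma>\<^sub>1 +++ \<gamma>\<^sub>2"
  have "arc_length ?\<gamma> 0 ((t+1)/2) = arc_length ?\<gamma> 0 (1/2) + arc_length ?\<gamma> (1/2) ((t+1)/2)"
    by (intro arc_length_add rectifiable_path_bdd_above rectifiable_path_join) (use assms in auto)
  also have "arc_length ?\<gamma> (1/2) ((t+1)/2) = arc_length \<gamma>\<^sub>2 0 t"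
    unfolding arc_length_def variation_sums_join_second[OF assms(3,4)] ..
  finally show ?thesis using arc_length_join_first[of 1 \<gamma>\<^sub>1 \<gamma>\<^sub>2] by simp
qed

lemma arc_param_join_first:
  assumes "rectifiable_path \<gamma>\<^sub>1" "rectifiable_path \<gamma>\<^sub>2" "pathfinish \<gamma>\<^sub>1 = pathstart \<gamma>\<^sub>2"
    and "s \<in> {0..arc_length \<gamma>\<^sub>1 0 1}"
  shows "arc_param (\<gamma>\<^sub>1 +++ \<gamma>\<^sub>2) s = arc_param \<gamma>\<^sub>1 s"
proof -
  obtain t where param: "t \<in> {0..1}" "arc_length \<gamma>\<^sub>1 0 t = s" using arc_length_surj[OF assms(1,4)] .
  then have "arc_param (\<gamma>\<^sub>1 +++ \<gamma>\<^sub>2) s = (\<gamma>\<^sub>1 +++ \<gamma>\<^sub>2) (t/2)"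
    using arc_param_arc_length[OF rectifiable_path_join[OF assms(1-3)], of "t/2"]
      arc_length_join_first[of t \<gamma>\<^sub>1 \<gamma>\<^sub>2] by auto
  then show ?thesis using joinpaths_first_half param arc_param_arc_length[OF assms(1)] by metis
qed

lemma arc_param_join_second:
  assumes "rectifiable_path \<gamma>\<^sub>1" "rectifiable_path \<gamma>\<^sub>2" "pathfinish \<gamma>\<^sub>1 = pathstart \<gamma>\<^sub>2"
    and "s \<in> {0..arc_length \<gamma>\<^sub>2 0 1}"
  shows "arc_param (\<gamma>\<^sub>1 +++ \<gamma>\<^sub>2) (s + arc_length \<gamma>\<^sub>1 0 1) = arc_param \<gamma>\<^sub>2 s"
proof -
  obtain t where param: "t \<in> {0..1}" "arc_length \<gamma>\<^sub>2 0 t = s" using arc_length_surj[OF assms(2,4)] .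
  then have "arc_param (\<gamma>\<^sub>1 +++ \<gamma>\<^sub>2) (s + arc_length \<gamma>\<^sub>1 0 1) = (\<gamma>\<^sub>1 +++ \<gamma>\<^sub>2) ((t+1)/2)"
    using arc_param_arc_length[OF rectifiable_path_join[OF assms(1-3)], of "(t+1)/2"]
      arc_length_join_second[OF assms(1-3), of t] by (auto simp: add.commute)
  then show ?thesis using joinpaths_second_half[OF assms(3)] param arc_param_arc_length[OF assms(2)]
    by metis
qed

lemma line_integral_join:
  fixes f :: "'a::euclidean_space \<Rightarrow> real"
  assumes path\<^sub>1: "rectifiable_path \<gamma>\<^sub>1" "path_image \<gamma>\<^sub>1 \<subseteq> G"
    and path\<^sub>2: "rectifiable_path \<gamma>\<^sub>2" "path_image \<gamma>\<^sub>2 \<subseteq> G"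
    and join: "pathfinish \<gamma>\<^sub>1 = pathstart \<gamma>\<^sub>2" and cont: "continuous_on G f"
  shows "line_integral f (\<gamma>\<^sub>1 +++ \<gamma>\<^sub>2) = line_integral f \<gamma>\<^sub>1 + line_integral f \<gamma>\<^sub>2"
proof -
  define L\<^sub>1 where "L\<^sub>1 = arc_length \<gamma>\<^sub>1 0 1"
  define L\<^sub>2 where "L\<^sub>2 = arc_length \<gamma>\<^sub>2 0 1"
  let ?F = "\<lambda>s. f (arc_param (\<gamma>\<^sub>1 +++ \<gamma>\<^sub>2) s)"
  have total: "arc_length (\<gamma>\<^sub>1 +++ \<gamma>\<^sub>2) 0 1 = L\<^sub>1 + L\<^sub>2"
    using arc_length_join_second[OF path\<^sub>1(1) path\<^sub>2(1) join, of 1] unfolding L\<^sub>1_def L\<^sub>2_def by simp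
  have "?F integrable_on {0..L\<^sub>1 + L\<^sub>2}"
    using arc_param_integrable[OF rectifiable_path_join[OF path\<^sub>1(1) path\<^sub>2(1) join] _ cont]
      path\<^sub>1(2) path\<^sub>2(2)
    by (simp add: total path_image_join join)
  then have "line_integral f (\<gamma>\<^sub>1 +++ \<gamma>\<^sub>2) = integral {0..L\<^sub>1} ?F + integral {L\<^sub>1..L\<^sub>1 + L\<^sub>2} ?F"
    unfolding line_integral_def total
    by (intro Henstock_Kurzweil_Integration.integral_combine[symmetric])
      (use arc_length_nonneg[OF path\<^sub>1(1), of 0 1] arc_length_nonneg[OF path\<^sub>2(1), of 0 1] in
        \<open>auto simp: L\<^sub>1_def L\<^sub>2_def\<close>)
  also have "integral {0..L\<^sub>1} ?F = line_integral f \<gamma>\<^sub>1"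
    unfolding line_integral_def L\<^sub>1_def
    by (intro integral_cong) (simp add: arc_param_join_first[OF path\<^sub>1(1) path\<^sub>2(1) join])
  also have "integral {L\<^sub>1..L\<^sub>1 + L\<^sub>2} ?F = integral {0..L\<^sub>2} (\<lambda>s. ?F (s + L\<^sub>1))"
    using integral_shift_real_ivl[of L\<^sub>1 L\<^sub>1 "L\<^sub>1 + L\<^sub>2" ?F] by simp
  also have "\<dots> = line_integral f \<gamma>\<^sub>2"
    unfolding line_integral_def L\<^sub>1_def L\<^sub>2_def
    by (intro integral_cong) (simp add: arc_param_join_second[OF path\<^sub>1(1) path\<^sub>2(1) join])
  finally show ?thesis .
qed

section \<open>Chains\<close>

text \<open>On an open \<open>G \<noteq> UNIV\<close> this agrees with \<^const>\<open>bdist\<close>, and it is easier to bound from below.\<close>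

definition codist :: "'a::metric_space set \<Rightarrow> 'a \<Rightarrow> real" where
  "codist G z = infdist z (- G)"

lemma codist_le: "w \<notin> G \<Longrightarrow> codist G z \<le> dist z w"
  unfolding codist_def by (simp add: infdist_le)

lemma codist_nonneg [simp]: "0 \<le> codist G z"
  unfolding codist_def by (rule infdist_nonneg)

lemma codist_triangle: "codist G z \<le> codist G w + dist z w"
  unfolding codist_def by (rule infdist_triangle)

lemma codist_ge:
  assumes "G \<noteq> UNIV" "\<And>w. w \<notin> G \<Longrightarrow> \<rho> \<le> dist z w"
  shows "\<rho> \<le> codist G z"
  unfolding codist_def using assms by (auto simp: infdist_def intro!: cINF_greatest)

lemma codist_pos:
  assumes "open G" "G \<noteq> UNIV" "z \<in> G" shows "0 < codist G z"
  unfolding codist_def using assms by (intro infdist_pos_not_in_closed) auto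

lemma codist_mono: "G \<subseteq> H \<Longrightarrow> H \<noteq> UNIV \<Longrightarrow> codist G z \<le> codist H z"
  by (rule codist_ge) (auto intro: codist_le)

lemma open_if_codist_pos:
  assumes "\<And>z. z \<in> G \<Longrightarrow> 0 < codist G z" shows "open G"
  unfolding open_contains_ball
proof
  fix z assume "z \<in> G"
  have "ball z (codist G z) \<subseteq> G" using codist_le[of _ G z] by force
  then show "\<exists>e>0. ball z e \<subseteq> G" using assms[OF \<open>z \<in> G\<close>] by blast
qed

lemma bdist_eq_codist:
  assumes "open G" "z \<in> G" "G \<noteq> UNIV"
  shows "bdist G z = codist G z"
proof (rule antisym)
  have "frontier G \<noteq> {}" using assms frontier_not_empty by blast
  then show "codist G z \<le> bdist G z"
    unfolding bdist_def codist_def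
    by (intro infdist_mono) (use assms in \<open>auto simp: frontier_def interior_open\<close>)
  show "bdist G z \<le> codist G z"
  proof (rule codist_ge[OF assms(3)])
    fix w assume "w \<notin> G"
    then obtain p where crossing: "p \<in> closed_segment z w" "p \<in> frontier G"
      using connected_Int_frontier[of "closed_segment z w" G] assms(2) by auto
    have "bdist G z \<le> dist z p" unfolding bdist_def by (rule infdist_le[OF crossing(2)])
    also have "\<dots> \<le> dist z w" using dist_in_closed_segment[OF crossing(1)]
      by (simp add: dist_commute)
    finally show "bdist G z \<le> dist z w" .
  qed
qed

definition chain_step :: "real \<Rightarrow> 'a::metric_space set \<Rightarrow> ('a \<times> 'a) set" where
  "chain_step l G = {(u, v). u \<in> G \<and> v \<in> G \<and> dist u v \<le> l * codist G u \<and> dist u v \<le> l * codist G v}"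

definition chain_uniform :: "(real \<Rightarrow> nat) \<Rightarrow> 'a::metric_space set \<Rightarrow> bool" where
  "chain_uniform f G \<longleftrightarrow> (\<forall>x\<in>G. \<forall>y\<in>G. \<forall>t. dist x y \<le> t * codist G x \<longrightarrow> dist x y \<le> t * codist G y \<longrightarrow>
      (x, y) \<in> chain_step (1/2) G ^^ f t)"

lemma chain_uniformD:
  assumes "chain_uniform f G" "x \<in> G" "y \<in> G" "dist x y \<le> t * codist G x" "dist x y \<le> t * codist G y"
  shows "(x, y) \<in> chain_step (1/2) G ^^ f t"
  using assms unfolding chain_uniform_def by blast

lemma chain_step_sym: "(u, v) \<in> chain_step l G \<Longrightarrow> (v, u) \<in> chain_step l G"
  unfolding chain_step_def by (auto simp: dist_commute)

lemma chain_step_if_third: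
  assumes "u \<in> G" "0 < codist G u" "dist u v \<le> codist G u / 3"
  shows "(u, v) \<in> chain_step (1/2) G"
proof -
  have "v \<in> G" using codist_le[of v G u] assms(2,3) by force
  then show ?thesis
    using assms codist_triangle[of G u v] unfolding chain_step_def by auto
qed

lemma chain_sym: "(u, v) \<in> chain_step l G ^^ n \<Longrightarrow> (v, u) \<in> chain_step l G ^^ n"
proof (induction n arbitrary: v)
  case (Suc n)
  then show ?case by (meson chain_step_sym relpow_Suc_E relpow_Suc_I2)
qed simp

lemma chain_pad:
  assumes "(u, v) \<in> chain_step l G ^^ m" "v \<in> G" "0 \<le> l" "m \<le> n"
  shows "(u, v) \<in> chain_step l G ^^ n"
proof -
  have "(v, v) \<in> chain_step l G" using assms(2,3) unfolding chain_step_def by simp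
  then have "(v, v) \<in> chain_step l G ^^ k" for k
    by (induction k) (auto intro: relpow_Suc_I)
  then show ?thesis using relpow_trans[OF assms(1), of v "n - m"] assms(4) by auto
qed

lemma chain_exists:
  assumes "open G" "connected G" "G \<noteq> UNIV" "x \<in> G" "y \<in> G"
  shows "\<exists>n. (x, y) \<in> chain_step (1/2) G ^^ n"
proof (rule connected_equivalence_relation[OF assms(2,4,5)])
  fix u v w assume "\<exists>n. (u, v) \<in> chain_step (1/2) G ^^ n" "\<exists>n. (v, w) \<in> chain_step (1/2) G ^^ n"
  then show "\<exists>n. (u, w) \<in> chain_step (1/2) G ^^ n" by (meson relpow_trans)
next
  fix a assume a_in_G: "a \<in> G"
  note pos = codist_pos[OF assms(1,3) a_in_G]
  have "(a, z) \<in> chain_step (1/2) G ^^ 1" if "z \<in> G \<inter> ball a (codist G a / 3)" for z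
    using chain_step_if_third[OF a_in_G pos] that by simp
  moreover have "openin (top_of_set G) (G \<inter> ball a (codist G a / 3))" by (simp add: openin_open_Int)
  moreover have "a \<in> G \<inter> ball a (codist G a / 3)" using a_in_G pos by simp
  ultimately show "\<exists>T. openin (top_of_set G) T \<and> a \<in> T \<and>
      (\<forall>z\<in>T. \<exists>n. (a, z) \<in> chain_step (1/2) G ^^ n)" by blast
qed (use chain_sym in blast)

lemma half_codist_le_on_segment:
  fixes u v :: "'a::euclidean_space"
  assumes "u \<in> G" "dist u v \<le> codist G u / 2" "z \<in> closed_segment u v"
  shows "z \<in> G" "codist G u / 2 \<le> codist G z"
proof -
  have near: "dist u z \<le> dist u v"
    using dist_in_closed_segment[OF assms(3)] by (simp add: dist_commute)
  show "codist G u / 2 \<le> codist G z" using near assms(2) codist_triangle[of G u z] by linarith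
  show "z \<in> G"
  proof (rule ccontr)
    assume "z \<notin> G"
    from codist_le[OF this, of u] have "dist u z \<le> 0" using near assms(2) by linarith
    then show False using \<open>z \<notin> G\<close> \<open>u \<in> G\<close> by simp
  qed
qed

section \<open>Quasihyperbolic length\<close>

definition rectifiable_paths :: "'a::euclidean_space set \<Rightarrow> 'a \<Rightarrow> 'a \<Rightarrow> (real \<Rightarrow> 'a) set" where
  "rectifiable_paths G x y =
     {\<gamma>. rectifiable_path \<gamma> \<and> path_image \<gamma> \<subseteq> G \<and> pathstart \<gamma> = x \<and> pathfinish \<gamma> = y}"

definition qh_length :: "'a::euclidean_space set \<Rightarrow> (real \<Rightarrow> 'a) \<Rightarrow> real" where
  "qh_length G \<gamma> = line_integral (\<lambda>z. 1 / codist G z) \<gamma>"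

lemma qh_metric_eq:
  assumes "open G" "G \<noteq> UNIV"
  shows "qh_metric G x y = Inf (qh_length G ` rectifiable_paths G x y)"
proof -
  have "line_integral (\<lambda>z. 1 / bdist G z) \<gamma> = qh_length G \<gamma>" if "\<gamma> \<in> rectifiable_paths G x y" for \<gamma>
    unfolding qh_length_def
  proof (rule line_integral_cong)
    show "rectifiable_path \<gamma>" using that unfolding rectifiable_paths_def by simp
    show "1 / bdist G z = 1 / codist G z" if "z \<in> path_image \<gamma>" for z
      using bdist_eq_codist[OF assms(1) _ assms(2), of z] that \<open>\<gamma> \<in> rectifiable_paths G x y\<close>
      unfolding rectifiable_paths_def by auto
  qed
  then have "qh_length G ` rectifiable_paths G x y =
      (\<lambda>\<gamma>. line_integral (\<lambda>z. 1 / bdist G z) \<gamma>) ` rectifiable_paths G x y"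
    by (intro image_cong) auto
  then show ?thesis unfolding qh_metric_def rectifiable_paths_def by (simp add: setcompr_eq_image)
qed

lemma qh_length_nonneg: "0 \<le> qh_length G \<gamma>"
proof (cases "(\<lambda>s. 1 / codist G (arc_param \<gamma> s)) integrable_on {0..arc_length \<gamma> 0 1}")
  case True
  then show ?thesis unfolding qh_length_def line_integral_def
    by (rule Henstock_Kurzweil_Integration.integral_nonneg) simp
qed (simp add: qh_length_def line_integral_def not_integrable_integral)

lemma qh_metric_le_qh_length:
  assumes "open G" "G \<noteq> UNIV" "\<gamma> \<in> rectifiable_paths G x y"
  shows "qh_metric G x y \<le> qh_length G \<gamma>"
  unfolding qh_metric_eq[OF assms(1,2)]
  using assms(3) by (intro cInf_lower bdd_belowI[of _ 0]) (auto simp: qh_length_nonneg)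

lemma continuous_on_inverse_codist:
  assumes "open G" "G \<noteq> UNIV"
  shows "continuous_on G (\<lambda>z. 1 / codist G z)"
  using codist_pos[OF assms] unfolding codist_def by (intro continuous_intros) fastforce

lemma join_rectifiable_paths:
  assumes "open G" "G \<noteq> UNIV" "\<gamma>\<^sub>1 \<in> rectifiable_paths G x y" "\<gamma>\<^sub>2 \<in> rectifiable_paths G y z"
  shows "\<gamma>\<^sub>1 +++ \<gamma>\<^sub>2 \<in> rectifiable_paths G x z"
    and "qh_length G (\<gamma>\<^sub>1 +++ \<gamma>\<^sub>2) = qh_length G \<gamma>\<^sub>1 + qh_length G \<gamma>\<^sub>2"
proof -
  show "\<gamma>\<^sub>1 +++ \<gamma>\<^sub>2 \<in> rectifiable_paths G x z"
    using assms(3,4) unfolding rectifiable_paths_def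
    by (auto simp: rectifiable_path_join path_image_join)
  show "qh_length G (\<gamma>\<^sub>1 +++ \<gamma>\<^sub>2) = qh_length G \<gamma>\<^sub>1 + qh_length G \<gamma>\<^sub>2"
    unfolding qh_length_def using assms(3,4) unfolding rectifiable_paths_def
    by (intro line_integral_join[OF _ _ _ _ _ continuous_on_inverse_codist[OF assms(1,2)]]) auto
qed

lemma linepath_qh_length_le:
  assumes open_proper: "open G" "G \<noteq> UNIV" and x_in_G: "x \<in> G" and near: "dist x y \<le> codist G x / 2"
  shows "linepath x y \<in> rectifiable_paths G x y"
    and "qh_length G (linepath x y) \<le> 2 * dist x y / codist G x"
proof -
  note on_segment = half_codist_le_on_segment[OF x_in_G near]
  have pos: "0 < codist G x" by (rule codist_pos[OF open_proper x_in_G])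
  have image: "path_image (linepath x y) \<subseteq> G" using on_segment(1) by auto
  then show "linepath x y \<in> rectifiable_paths G x y"
    unfolding rectifiable_paths_def by (simp add: rectifiable_linepath)
  have "1 / codist G z \<le> 2 / codist G x" if "z \<in> path_image (linepath x y)" for z
    using on_segment(2)[of z] that pos by (auto simp: field_simps)
  then have "qh_length G (linepath x y) \<le> 2 / codist G x * arc_length (linepath x y) 0 1"
    unfolding qh_length_def
    by (intro line_integral_le[OF rectifiable_linepath image continuous_on_inverse_codist[OF open_proper]])
  also have "\<dots> \<le> 2 / codist G x * dist x y"
    using arc_length_linepath_le pos by (intro mult_left_mono) auto
  finally show "qh_length G (linepath x y) \<le> 2 * dist x y / codist G x" by simp
qed

lemma chain_imp_rectifiable_path:
  assumes open_proper: "open G" "G \<noteq> UNIV" and x_in_G: "x \<in> G"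
    and chain: "(x, y) \<in> chain_step (1/2) G ^^ n"
  shows "\<exists>\<gamma>\<in>rectifiable_paths G x y. qh_length G \<gamma> \<le> real n"
  using chain
proof (induction n arbitrary: y)
  case 0
  then have "y = x" by simp
  have "linepath x x \<in> rectifiable_paths G x x" "qh_length G (linepath x x) \<le> 0"
    using linepath_qh_length_le[OF open_proper x_in_G, of x] by auto
  then show ?case unfolding \<open>y = x\<close> of_nat_0 by blast
next
  case (Suc n)
  then obtain z where split: "(x, z) \<in> chain_step (1/2) G ^^ n" "(z, y) \<in> chain_step (1/2) G"
    by auto
  obtain \<gamma> where path: "\<gamma> \<in> rectifiable_paths G x z" "qh_length G \<gamma> \<le> real n"
    using Suc.IH[OF split(1)] by blast
  have step: "z \<in> G" "dist z y \<le> codist G z / 2" using split(2) unfolding chain_step_def by auto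
  have "2 * dist z y / codist G z \<le> 1"
    using step codist_pos[OF open_proper step(1)] by (simp add: field_simps)
  then have "qh_length G (\<gamma> +++ linepath z y) \<le> real (Suc n)"
    using join_rectifiable_paths(2)[OF open_proper path(1)] linepath_qh_length_le[OF open_proper step]
      path(2) by force
  then show ?case using join_rectifiable_paths(1)[OF open_proper path(1)]
      linepath_qh_length_le(1)[OF open_proper step] by blast
qed

lemma lipschitz_curve_integrable:
  fixes g :: "real \<Rightarrow> 'a::metric_space"
  assumes "open G" "G \<noteq> UNIV" "1-lipschitz_on {a..b} g" "g ` {a..b} \<subseteq> G"
  shows "(\<lambda>s. 1 / codist G (g s)) integrable_on {a..b}"
  using continuous_on_compose2[OF continuous_on_inverse_codist[OF assms(1,2)]
      lipschitz_on_continuous_on[OF assms(3)] assms(4)]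
  by (rule integrable_continuous_real)

lemma lipschitz_curve_quarter:
  fixes g :: "real \<Rightarrow> 'a::metric_space"
  assumes open_proper: "open G" "G \<noteq> UNIV" and curve: "1-lipschitz_on {a..b} g" "g ` {a..b} \<subseteq> G"
    and b_eq: "a + codist G (g a) / 3 = b"
  shows "1/4 \<le> integral {a..b} (\<lambda>s. 1 / codist G (g s))"
proof -
  define \<delta> where "\<delta> = codist G (g a)"
  have "a \<le> b" using b_eq codist_nonneg[of G "g a"] by linarith
  then have \<delta>_pos: "0 < \<delta>" unfolding \<delta>_def using curve(2) by (intro codist_pos[OF open_proper]) auto
  have "1/4 = integral {a..b} (\<lambda>_. 3 / (4 * \<delta>))"
    using \<delta>_pos b_eq unfolding \<delta>_def by (simp add: field_simps)
  also have "\<dots> \<le> integral {a..b} (\<lambda>s. 1 / codist G (g s))"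
  proof (intro integral_le lipschitz_curve_integrable[OF open_proper curve] integrable_const_ivl)
    fix s assume s_in: "s \<in> {a..b}"
    have "dist (g s) (g a) \<le> \<delta> / 3"
      using lipschitz_onD[OF curve(1) s_in, of a] s_in \<open>a \<le> b\<close> b_eq unfolding \<delta>_def
      by (auto simp: dist_real_def)
    then have "codist G (g s) \<le> 4 * \<delta> / 3"
      using codist_triangle[of G "g s" "g a"] unfolding \<delta>_def by simp
    moreover have "0 < codist G (g s)"
      using s_in curve(2) by (intro codist_pos[OF open_proper]) blast
    ultimately show "3 / (4 * \<delta>) \<le> 1 / codist G (g s)" using \<delta>_pos by (simp add: field_simps)
  qed
  finally show ?thesis .
qed

lemma lipschitz_curve_remaining_length:
  fixes g :: "real \<Rightarrow> 'a::metric_space"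
  assumes open_proper: "open G" "G \<noteq> UNIV" and curve: "1-lipschitz_on {a..b} g" "g ` {a..b} \<subseteq> G"
    and advance: "c = a + codist G (g a) / 3" "c \<le> b"
  shows "0 \<le> integral {c..b} (\<lambda>s. 1 / codist G (g s))"
    and "integral {c..b} (\<lambda>s. 1 / codist G (g s)) \<le> integral {a..b} (\<lambda>s. 1 / codist G (g s)) - 1/4"
proof -
  have "a \<le> c" unfolding advance(1) by simp
  then have subintervals: "{a..c} \<subseteq> {a..b}" "{c..b} \<subseteq> {a..b}" using advance(2) by auto
  have "(\<lambda>s. 1 / codist G (g s)) integrable_on {c..b}"
    using subintervals(2) curve(2)
    by (intro lipschitz_curve_integrable[OF open_proper lipschitz_on_subset[OF curve(1)]]) auto
  then show "0 \<le> integral {c..b} (\<lambda>s. 1 / codist G (g s))"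
    by (rule Henstock_Kurzweil_Integration.integral_nonneg) simp
  have "1/4 \<le> integral {a..c} (\<lambda>s. 1 / codist G (g s))"
    using subintervals(1) curve(2) advance(1)
    by (intro lipschitz_curve_quarter[OF open_proper lipschitz_on_subset[OF curve(1)]]) auto
  then show "integral {c..b} (\<lambda>s. 1 / codist G (g s)) \<le> integral {a..b} (\<lambda>s. 1 / codist G (g s)) - 1/4"
    using Henstock_Kurzweil_Integration.integral_combine[OF \<open>a \<le> c\<close> advance(2)
        lipschitz_curve_integrable[OF open_proper curve]]
    by simp
qed

lemma lipschitz_curve_chain_step:
  fixes g :: "real \<Rightarrow> 'a::metric_space"
  assumes open_proper: "open G" "G \<noteq> UNIV" and curve: "1-lipschitz_on {a..b} g" "g ` {a..b} \<subseteq> G"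
    and s_near: "s \<in> {a..b}" "s - a \<le> codist G (g a) / 3"
  shows "(g a, g s) \<in> chain_step (1/2) G"
proof (rule chain_step_if_third)
  have a_in: "a \<in> {a..b}" using s_near(1) by simp
  then show "g a \<in> G" using curve(2) by blast
  then show "0 < codist G (g a)" by (rule codist_pos[OF open_proper])
  show "dist (g a) (g s) \<le> codist G (g a) / 3"
    using lipschitz_onD[OF curve(1) a_in s_near(1)] s_near by (auto simp: dist_real_def)
qed

text \<open>Each step advances by a third of the distance to the complement, which consumes
  quasihyperbolic length at least \<open>1/4\<close>.\<close>

lemma lipschitz_curve_imp_chain:
  fixes g :: "real \<Rightarrow> 'a::metric_space"
  assumes open_proper: "open G" "G \<noteq> UNIV"
    and "1-lipschitz_on {a..b} g" "g ` {a..b} \<subseteq> G" "a \<le> b"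
    and "integral {a..b} (\<lambda>s. 1 / codist G (g s)) \<le> real n / 4"
  shows "(g a, g b) \<in> chain_step (1/2) G ^^ Suc n"
  using assms(3-)
proof (induction n arbitrary: a)
  case (0 a)
  have "\<not> a + codist G (g a) / 3 \<le> b"
    using lipschitz_curve_remaining_length[OF open_proper 0(1,2) refl] 0(4) by fastforce
  then show ?case using lipschitz_curve_chain_step[OF open_proper 0(1,2), of b] 0(3) by simp
next
  case (Suc n a)
  note step = lipschitz_curve_chain_step[OF open_proper Suc.prems(1,2)]
  define c where "c = a + codist G (g a) / 3"
  show ?case
  proof (cases "c \<le> b")
    case True
    then have c_in: "c \<in> {a..b}" unfolding c_def by simp
    have "(g c, g b) \<in> chain_step (1/2) G ^^ Suc n"
      using c_in Suc.prems lipschitz_curve_remaining_length(2)[OF open_proper Suc.prems(1,2) c_def True]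
      by (intro Suc.IH lipschitz_on_subset[OF Suc.prems(1)]) (auto simp: add_divide_distrib)
    moreover have "(g a, g c) \<in> chain_step (1/2) G" by (rule step[OF c_in]) (simp add: c_def)
    ultimately show ?thesis by (rule relpow_Suc_I2[rotated])
  next
    case False
    then have "(g a, g b) \<in> chain_step (1/2) G ^^ 1"
      using step[of b] Suc.prems(3) unfolding c_def by simp
    then show ?thesis by (rule chain_pad) (use Suc.prems in auto)
  qed
qed

lemma rectifiable_path_imp_chain:
  assumes open_proper: "open G" "G \<noteq> UNIV"
    and path: "\<gamma> \<in> rectifiable_paths G x y" "qh_length G \<gamma> \<le> real n / 4"
  shows "(x, y) \<in> chain_step (1/2) G ^^ Suc n"
proof -
  have rect: "rectifiable_path \<gamma>" "path_image \<gamma> \<subseteq> G" "\<gamma> 0 = x" "\<gamma> 1 = y"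
    using path(1) unfolding rectifiable_paths_def pathstart_def pathfinish_def by auto
  have "(arc_param \<gamma> 0, arc_param \<gamma> (arc_length \<gamma> 0 1)) \<in> chain_step (1/2) G ^^ Suc n"
    using path(2) arc_length_nonneg[OF rect(1), of 0 1] arc_param_in_path_image[OF rect(1)] rect(2)
    by (intro lipschitz_curve_imp_chain[OF open_proper arc_param_lipschitz[OF rect(1)]])
      (auto simp: qh_length_def line_integral_def)
  then show ?thesis
    using arc_param_arc_length[OF rect(1), of 0] arc_param_arc_length[OF rect(1), of 1] rect(3,4)
    by simp
qed

lemma qh_metric_less_imp_chain:
  assumes "open G" "connected G" "G \<noteq> UNIV" "x \<in> G" "y \<in> G" "qh_metric G x y < real n / 4"
  shows "(x, y) \<in> chain_step (1/2) G ^^ Suc n"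
proof -
  have "rectifiable_paths G x y \<noteq> {}"
    using chain_exists[OF assms(1-5)] chain_imp_rectifiable_path[OF assms(1,3,4)] by blast
  then obtain \<gamma> where "\<gamma> \<in> rectifiable_paths G x y" "qh_length G \<gamma> < real n / 4"
    using cInf_lessD[of "qh_length G ` rectifiable_paths G x y"] assms(6)
    unfolding qh_metric_eq[OF assms(1,3)] by blast
  then show ?thesis using rectifiable_path_imp_chain[OF assms(1,3)] by simp
qed

section \<open>Uniformity in terms of chains\<close>

lemma halfline_homeo_bound:
  assumes "halfline_homeo \<phi>"
  shows "\<exists>n::nat. \<forall>s\<in>{0..t}. \<phi> s < real n / 4"
proof -
  have "continuous_on {0..t} \<phi>"
    using assms unfolding halfline_homeo_def homeomorphism_def by (auto elim: continuous_on_subset)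
  then have "bdd_above (\<phi> ` {0..t})"
    by (intro bounded_imp_bdd_above compact_imp_bounded compact_continuous_image) auto
  then obtain B where upper: "\<And>s. s \<in> {0..t} \<Longrightarrow> \<phi> s \<le> B" unfolding bdd_above_def by blast
  obtain n :: nat where "4 * B < real n" using reals_Archimedean2 by blast
  then show ?thesis using upper by (intro exI[of _ n]) force
qed

lemma uniform_imp_chain_uniform:
  assumes "halfline_homeo \<phi>"
  obtains f where "\<And>G :: 'a::euclidean_space set. uniform_domain \<phi> G \<Longrightarrow> chain_uniform f G"
proof -
  obtain N :: "real \<Rightarrow> nat" where \<phi>_less: "\<And>t s. s \<in> {0..t} \<Longrightarrow> \<phi> s < real (N t) / 4"
    using halfline_homeo_bound[OF assms] by metis
  show thesis
  proof
    fix G :: "'a set" assume uniform: "uniform_domain \<phi> G"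
    then have domain_G: "open G" "connected G" "G \<noteq> UNIV"
      unfolding uniform_domain_def domain_def by auto
    show "chain_uniform (\<lambda>t. Suc (N t)) G" unfolding chain_uniform_def
    proof (intro ballI allI impI)
      fix x y t assume x_in_G: "x \<in> G" and y_in_G: "y \<in> G"
        and ratio: "dist x y \<le> t * codist G x" "dist x y \<le> t * codist G y"
      let ?m = "min (codist G x) (codist G y)"
      have "0 < ?m" using codist_pos[OF domain_G(1,3)] x_in_G y_in_G by simp
      then have "dist x y / ?m \<in> {0..t}" using ratio by (auto simp: pos_divide_le_eq min_def)
      moreover have "qh_metric G x y \<le> \<phi> (dist x y / ?m)"
        using uniform x_in_G y_in_G bdist_eq_codist[OF domain_G(1) _ domain_G(3)]
        unfolding uniform_domain_def by metis
      ultimately have "qh_metric G x y < real (N t) / 4" by (meson \<phi>_less le_less_trans)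
      then show "(x, y) \<in> chain_step (1/2) G ^^ Suc (N t)"
        by (rule qh_metric_less_imp_chain[OF domain_G x_in_G y_in_G])
    qed
  qed
qed

lemma continuous_on_atLeastI:
  fixes f :: "real \<Rightarrow> 'a::topological_space"
  assumes "\<And>b. continuous_on {a..b} f" shows "continuous_on {a..} f"
  unfolding continuous_on_eq_continuous_within
proof
  fix x assume x_ge: "x \<in> {a..}"
  have "at x within {a..x+1} = at x within {a..}" by (rule at_within_nhd[of x "{..<x+1}"]) auto
  then show "continuous (at x within {a..}) f"
    using assms[of "x+1"] x_ge unfolding continuous_on_eq_continuous_within continuous_within
    by (metis atLeastAtMost_iff atLeast_iff le_add_same_cancel1 zero_le_one)
qed

lemma halfline_homeoI:
  assumes cont: "\<And>b. continuous_on {0..b} \<phi>" and mono: "strict_mono_on {0..} \<phi>"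
    and zero: "\<phi> 0 = 0" and ge_id: "\<And>t. 0 \<le> t \<Longrightarrow> t \<le> \<phi> t"
  shows "halfline_homeo \<phi>"
  unfolding halfline_homeo_def
proof (rule homeomorphism_into_1d)
  show "\<phi> ` {0..} = {0..}"
  proof (intro equalityI subsetI)
    fix y :: real assume "y \<in> {0..}"
    then have "\<exists>x\<ge>0. x \<le> y \<and> \<phi> x = y"
      using IVT'[of \<phi> 0 y y] cont[of y] ge_id[of y] zero by auto
    then show "y \<in> \<phi> ` {0..}" by force
  next
    fix y assume "y \<in> \<phi> ` {0..}"
    then show "y \<in> {0..}" using ge_id by force
  qed
qed (use cont mono in \<open>auto intro: continuous_on_atLeastI strict_mono_on_imp_inj_on
      convex_imp_path_connected\<close>)

lemma mono_integrable_on: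
  fixes g :: "real \<Rightarrow> real" assumes "mono g" shows "g integrable_on {a..b}"
  using assms by (intro integrable_on_mono_on) (auto intro: mono_onI monoD)

lemma halfline_homeo_integral:
  fixes g :: "real \<Rightarrow> real"
  assumes mono_nonneg: "mono g" "\<And>s. 0 \<le> g s"
  shows "halfline_homeo (\<lambda>t. 2 * t + integral {0..4*t} g)"
proof (rule halfline_homeoI)
  have nonneg: "0 \<le> integral {a..b} g" for a b
    using mono_integrable_on[OF mono_nonneg(1)] mono_nonneg(2)
    by (intro Henstock_Kurzweil_Integration.integral_nonneg) auto
  show "continuous_on {0..b} (\<lambda>t. 2 * t + integral {0..4*t} g)" for b
    by (intro continuous_intros continuous_on_compose2[OF indefinite_integral_continuous_1[
            OF mono_integrable_on[OF mono_nonneg(1)], of 0 "4*b"]]) auto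
  show "strict_mono_on {0..} (\<lambda>t. 2 * t + integral {0..4*t} g)"
  proof (rule strict_mono_onI)
    fix a b :: real assume "a \<in> {0..}" "a < b"
    then show "2 * a + integral {0..4*a} g < 2 * b + integral {0..4*b} g"
      using Henstock_Kurzweil_Integration.integral_combine[of 0 "4*a" "4*b" g]
        mono_integrable_on[OF mono_nonneg(1)] nonneg[of "4*a" "4*b"] by simp
  qed
  show "t \<le> 2 * t + integral {0..4*t} g" if "0 \<le> t" for t using that nonneg[of 0 "4*t"] by linarith
qed simp

lemma mono_le_integral:
  fixes g :: "real \<Rightarrow> real"
  assumes mono_nonneg: "mono g" "\<And>s. 0 \<le> g s" and t_ge: "1/2 \<le> t"
  shows "g t \<le> integral {0..4*t} g"
proof -
  note integrable = mono_integrable_on[OF mono_nonneg(1)]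
  have "g t \<le> g (2*t)" using t_ge by (intro monoD[OF mono_nonneg(1)]) simp
  also have "\<dots> \<le> 2*t * g (2*t)"
    using mult_right_mono[of 1 "2*t" "g (2*t)"] mono_nonneg(2) t_ge by simp
  also have "\<dots> = integral {2*t..4*t} (\<lambda>_. g (2*t))" using t_ge by simp
  also have "\<dots> \<le> integral {2*t..4*t} g"
    using integrable by (intro integral_le) (auto intro: monoD[OF mono_nonneg(1)])
  also have "\<dots> \<le> integral {0..4*t} g"
    using integrable mono_nonneg(2) t_ge by (intro integral_subset_le) auto
  finally show ?thesis .
qed

lemma halfline_homeo_majorant:
  fixes f :: "real \<Rightarrow> nat"
  obtains \<phi> where "halfline_homeo \<phi>" "\<And>t. 0 \<le> t \<Longrightarrow> 2 * t \<le> \<phi> t"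
    "\<And>t. 1/2 \<le> t \<Longrightarrow> real (f (real (nat \<lceil>t\<rceil>))) \<le> \<phi> t"
proof -
  define g where "g s = real (\<Sum>n\<le>nat \<lceil>s\<rceil>. f (real n))" for s :: real
  have nonneg: "0 \<le> g s" for s unfolding g_def by (rule of_nat_0_le_iff)
  have mono: "mono g"
  proof (rule monoI)
    fix s s' :: real assume "s \<le> s'"
    then have "nat \<lceil>s\<rceil> \<le> nat \<lceil>s'\<rceil>" by (intro nat_mono ceiling_mono)
    then show "g s \<le> g s'" unfolding g_def by (intro of_nat_mono sum_mono2) auto
  qed
  show thesis
  proof
    show "halfline_homeo (\<lambda>t. 2 * t + integral {0..4*t} g)"
      by (rule halfline_homeo_integral[OF mono nonneg])
    show "2 * t \<le> 2 * t + integral {0..4*t} g" for t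
      using Henstock_Kurzweil_Integration.integral_nonneg[OF mono_integrable_on[OF mono] nonneg]
      by simp
    fix t :: real assume t_ge: "1/2 \<le> t"
    have "f (real (nat \<lceil>t\<rceil>)) \<le> (\<Sum>n\<le>nat \<lceil>t\<rceil>. f (real n))" by (rule member_le_sum) auto
    then have "real (f (real (nat \<lceil>t\<rceil>))) \<le> g t" unfolding g_def by (rule of_nat_mono)
    also have "g t \<le> integral {0..4*t} g" by (rule mono_le_integral[OF mono nonneg t_ge])
    finally show "real (f (real (nat \<lceil>t\<rceil>))) \<le> 2 * t + integral {0..4*t} g" using t_ge by linarith
  qed
qed

lemma chain_uniform_imp_rectifiable_path:
  assumes "open G" "G \<noteq> UNIV" "chain_uniform f G" "x \<in> G" "y \<in> G"
    and "dist x y \<le> t * codist G x" "dist x y \<le> t * codist G y"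
  shows "\<exists>\<gamma>\<in>rectifiable_paths G x y. qh_length G \<gamma> \<le> real (f t)"
  using chain_imp_rectifiable_path[OF assms(1,2,4)] chain_uniformD[OF assms(3-)] by blast

lemma dist_le_ratio_mult_codist:
  assumes "0 < codist G x" "0 < codist G y"
  shows "dist x y \<le> dist x y / min (codist G x) (codist G y) * codist G x"
    and "dist x y \<le> dist x y / min (codist G x) (codist G y) * codist G y"
  using assms mult_right_mono[of "codist G x" "codist G y" "dist x y"]
    mult_right_mono[of "codist G y" "codist G x" "dist x y"]
  by (auto simp: min_def field_simps)

lemma chain_uniform_imp_connected:
  fixes G :: "'a::euclidean_space set"
  assumes "open G" "G \<noteq> UNIV" "chain_uniform f G" shows "connected G"
proof (rule path_connected_imp_connected, unfold path_connected_def, intro ballI)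
  fix x y assume in_G: "x \<in> G" "y \<in> G"
  define t where "t = dist x y / min (codist G x) (codist G y)"
  have "dist x y \<le> t * codist G x" "dist x y \<le> t * codist G y"
    unfolding t_def using dist_le_ratio_mult_codist codist_pos[OF assms(1,2)] in_G by blast+
  then have "rectifiable_paths G x y \<noteq> {}"
    using chain_uniform_imp_rectifiable_path[OF assms in_G] by blast
  then show "\<exists>\<gamma>. path \<gamma> \<and> path_image \<gamma> \<subseteq> G \<and> pathstart \<gamma> = x \<and> pathfinish \<gamma> = y"
    unfolding rectifiable_paths_def rectifiable_path_def by blast
qed

lemma qh_metric_le_majorant:
  assumes open_proper: "open G" "G \<noteq> UNIV" and chain_unif: "chain_uniform f G"
    and majorant: "\<And>t. 0 \<le> t \<Longrightarrow> 2 * t \<le> \<phi> t" "\<And>t. 1/2 \<le> t \<Longrightarrow> real (f (real (nat \<lceil>t\<rceil>))) \<le> \<phi> t"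
    and x_in_G: "x \<in> G" and y_in_G: "y \<in> G"
  shows "qh_metric G x y \<le> \<phi> (dist x y / min (codist G x) (codist G y))"
proof -
  define t where "t = dist x y / min (codist G x) (codist G y)"
  have pos: "0 < codist G x" "0 < codist G y" using codist_pos[OF open_proper] x_in_G y_in_G by auto
  then have ratio: "0 \<le> t" "dist x y \<le> t * codist G x" "dist x y \<le> t * codist G y"
    unfolding t_def using dist_le_ratio_mult_codist[OF pos] by auto
  have "qh_metric G x y \<le> \<phi> t"
  proof (cases "1/2 \<le> t")
    case True
    have "t * codist G z \<le> real (nat \<lceil>t\<rceil>) * codist G z" for z
      by (intro mult_right_mono) (simp_all add: real_nat_ceiling_ge)
    then have "\<exists>\<gamma>\<in>rectifiable_paths G x y. qh_length G \<gamma> \<le> real (f (real (nat \<lceil>t\<rceil>)))"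
      using ratio by (intro chain_uniform_imp_rectifiable_path[OF open_proper chain_unif x_in_G y_in_G])
          (auto intro: order_trans)
    then have "qh_metric G x y \<le> real (f (real (nat \<lceil>t\<rceil>)))"
      using qh_metric_le_qh_length[OF open_proper] by fastforce
    then show ?thesis using majorant(2)[OF True] by linarith
  next
    case False
    then have "t * codist G x \<le> 1/2 * codist G x" using pos by (intro mult_right_mono) auto
    then have near: "dist x y \<le> codist G x / 2" using ratio(2) by linarith
    have "qh_metric G x y \<le> 2 * dist x y / codist G x"
      using qh_metric_le_qh_length[OF open_proper linepath_qh_length_le(1)[OF open_proper x_in_G near]]
        linepath_qh_length_le(2)[OF open_proper x_in_G near] by linarith
    also have "\<dots> \<le> 2 * t" using ratio(2) pos by (simp add: pos_divide_le_eq)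
    finally show ?thesis using majorant(1)[OF ratio(1)] by linarith
  qed
  then show ?thesis unfolding t_def .
qed

lemma chain_uniform_imp_uniform:
  fixes f :: "real \<Rightarrow> nat"
  obtains \<phi> where "halfline_homeo \<phi>"
    "\<And>G :: 'a::euclidean_space set. open G \<Longrightarrow> G \<noteq> {} \<Longrightarrow> G \<noteq> UNIV \<Longrightarrow> chain_uniform f G \<Longrightarrow> uniform_domain \<phi> G"
proof -
  obtain \<phi> where majorant: "halfline_homeo \<phi>" "\<And>t. 0 \<le> t \<Longrightarrow> 2 * t \<le> \<phi> t"
    "\<And>t. 1/2 \<le> t \<Longrightarrow> real (f (real (nat \<lceil>t\<rceil>))) \<le> \<phi> t"
    using halfline_homeo_majorant by blast
  show thesis
  proof (rule that[OF majorant(1)])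
    fix G :: "'a set" assume G_props: "open G" "G \<noteq> {}" "G \<noteq> UNIV" and chain_unif: "chain_uniform f G"
    then show "uniform_domain \<phi> G"
      using qh_metric_le_majorant[OF G_props(1,3) chain_unif majorant(2,3)]
        chain_uniform_imp_connected[OF G_props(1,3) chain_unif]
      unfolding uniform_domain_def domain_def by (simp add: bdist_eq_codist)
  qed
qed

section \<open>Subdivided chains and chains on spheres\<close>

lemma segment_chain:
  fixes u v :: "'a::euclidean_space"
  assumes short_step: "\<And>z w. z \<in> closed_segment u v \<Longrightarrow> w \<in> closed_segment u v \<Longrightarrow> dist z w \<le> e \<Longrightarrow> (z, w) \<in> R"
    and total: "dist u v \<le> real K * e" and K_pos: "0 < K"
  shows "(u, v) \<in> R ^^ K"
proof -
  define p where "p k = u + (real k / real K) *\<^sub>R (v - u)" for k :: nat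
  have in_segment: "p k \<in> closed_segment u v" if "k \<le> K" for k
  proof -
    have "p k = (1 - real k / real K) *\<^sub>R u + (real k / real K) *\<^sub>R v"
      unfolding p_def by (simp add: algebra_simps)
    then show ?thesis unfolding closed_segment_def using that K_pos by force
  qed
  have "dist (p k) (p (Suc k)) \<le> e" for k
  proof -
    have "p (Suc k) - p k = (1 / real K) *\<^sub>R (v - u)"
      unfolding p_def by (simp add: algebra_simps add_divide_distrib)
    then have "dist (p k) (p (Suc k)) = dist u v / real K"
      unfolding dist_commute[of "p k"] dist_commute[of u] by (simp add: dist_norm)
    then show ?thesis using total K_pos by (simp add: pos_divide_le_eq mult.commute)
  qed
  then have "(p k, p (Suc k)) \<in> R" if "k < K" for k using that by (intro short_step in_segment) auto
  then have "(p 0, p K) \<in> R ^^ K" unfolding relpow_fun_conv by blast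
  then show ?thesis using K_pos by (simp add: p_def)
qed

lemma relpow_map:
  assumes "\<And>u v. (u, v) \<in> R \<Longrightarrow> (h u, h v) \<in> S ^^ K" and "(u, v) \<in> R ^^ n"
  shows "(h u, h v) \<in> S ^^ (n * K)"
  using assms(2)
proof (induction n arbitrary: v)
  case (Suc n)
  then obtain w where "(u, w) \<in> R ^^ n" "(w, v) \<in> R" by auto
  then have "(h u, h w) \<in> S ^^ (n * K)" "(h w, h v) \<in> S ^^ K" using Suc.IH assms(1) by auto
  then show ?case using relpow_trans by (metis add.commute mult_Suc)
qed simp

lemma chain_step_refine:
  fixes u v :: "'a::euclidean_space"
  assumes step: "(u, v) \<in> chain_step (1/2) G" and l_pos: "0 < l"
  shows "(u, v) \<in> chain_step l G ^^ nat \<lceil>1 / l\<rceil>"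
proof (rule segment_chain[where e = "l * (codist G u / 2)"])
  have half_step: "u \<in> G" "dist u v \<le> codist G u / 2" using step unfolding chain_step_def by auto
  note on_segment = half_codist_le_on_segment[OF half_step]
  show "(z, w) \<in> chain_step l G"
    if z_in: "z \<in> closed_segment u v" and w_in: "w \<in> closed_segment u v"
      and near: "dist z w \<le> l * (codist G u / 2)" for z w
  proof -
    have "l * (codist G u / 2) \<le> l * codist G z" "l * (codist G u / 2) \<le> l * codist G w"
      using on_segment(2)[OF z_in] on_segment(2)[OF w_in] l_pos
      by (simp_all only: mult_le_cancel_left_pos)
    then have "dist z w \<le> l * codist G z" "dist z w \<le> l * codist G w" using near by linarith+
    then show ?thesis using on_segment(1)[OF z_in] on_segment(1)[OF w_in]
      unfolding chain_step_def by simp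
  qed
  have "1 \<le> real (nat \<lceil>1 / l\<rceil>) * l"
    using real_nat_ceiling_ge[of "1 / l"] l_pos by (simp only: pos_divide_le_eq)
  from mult_right_mono[OF this, of "codist G u / 2"]
  show "dist u v \<le> real (nat \<lceil>1 / l\<rceil>) * (l * (codist G u / 2))"
    using half_step(2) by (simp add: mult.assoc)
  show "0 < nat \<lceil>1 / l\<rceil>" using l_pos by simp
qed

lemma chain_refine:
  fixes x y :: "'a::euclidean_space"
  assumes "(x, y) \<in> chain_step (1/2) G ^^ n" "0 < l"
  shows "(x, y) \<in> chain_step l G ^^ (n * nat \<lceil>1 / l\<rceil>)"
  using relpow_map[of "chain_step (1/2) G" "\<lambda>u. u"] chain_step_refine assms by blast

definition radial_proj :: "'a::real_normed_vector \<Rightarrow> real \<Rightarrow> 'a \<Rightarrow> 'a" where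
  "radial_proj a \<rho> z = a + (\<rho> / dist a z) *\<^sub>R (z - a)"

lemma radial_proj_in_sphere: "z \<noteq> a \<Longrightarrow> 0 \<le> \<rho> \<Longrightarrow> radial_proj a \<rho> z \<in> sphere a \<rho>"
  by (simp add: radial_proj_def dist_norm norm_minus_commute)

lemma radial_proj_sphere: "z \<in> sphere a \<rho> \<Longrightarrow> z \<noteq> a \<Longrightarrow> radial_proj a \<rho> z = z"
  by (auto simp: radial_proj_def)

lemma dist_radial_proj:
  assumes "z \<noteq> a"
  shows "dist z (radial_proj a \<rho> z) = \<bar>dist a z - \<rho>\<bar>"
proof -
  have "z - radial_proj a \<rho> z = (1 - \<rho> / dist a z) *\<^sub>R (z - a)"
    unfolding radial_proj_def by (simp add: algebra_simps)
  then have "dist z (radial_proj a \<rho> z) = \<bar>(1 - \<rho> / dist a z) * dist a z\<bar>"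
    by (simp add: dist_norm norm_minus_commute abs_mult)
  then show ?thesis using assms by (simp add: left_diff_distrib)
qed

lemma dist_radial_proj_le:
  assumes "x \<noteq> a" "y \<noteq> a" "0 \<le> \<rho>"
  shows "dist (radial_proj a \<rho> x) (radial_proj a \<rho> y) \<le> 2 * \<rho> / dist a x * dist x y"
proof -
  define \<mu> where "\<mu> = \<rho> / dist a x"
  have \<mu>_props: "0 \<le> \<mu>" "\<mu> * dist a x = \<rho>" unfolding \<mu>_def using assms by auto
  have "radial_proj a \<rho> x - radial_proj a \<rho> y = \<mu> *\<^sub>R (x - y) + (\<mu> - \<rho> / dist a y) *\<^sub>R (y - a)"
    unfolding radial_proj_def \<mu>_def by (simp add: algebra_simps)
  then have "dist (radial_proj a \<rho> x) (radial_proj a \<rho> y) \<le>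
      norm (\<mu> *\<^sub>R (x - y)) + norm ((\<mu> - \<rho> / dist a y) *\<^sub>R (y - a))"
    unfolding dist_norm[of "radial_proj a \<rho> x"] by (simp only: norm_triangle_ineq)
  also have "norm ((\<mu> - \<rho> / dist a y) *\<^sub>R (y - a)) = \<bar>(\<mu> - \<rho> / dist a y) * dist a y\<bar>"
    by (simp add: dist_norm norm_minus_commute abs_mult)
  also have "(\<mu> - \<rho> / dist a y) * dist a y = \<mu> * (dist a y - dist a x)"
    using \<mu>_props(2) assms(2) by (simp add: left_diff_distrib right_diff_distrib)
  also have "\<bar>\<mu> * (dist a y - dist a x)\<bar> = \<mu> * \<bar>dist a y - dist a x\<bar>"
    using \<mu>_props(1) by (simp add: abs_mult)
  also have "\<dots> \<le> \<mu> * dist x y"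
    using \<mu>_props(1) dist_triangle[of a x y] dist_triangle[of a y x]
    by (intro mult_left_mono) (auto simp: dist_commute)
  finally show ?thesis using assms(3) by (simp add: \<mu>_def dist_norm)
qed

lemma norm_segment_ge:
  fixes p q :: "'a::real_inner"
  assumes "norm p = \<rho>" "norm q = \<rho>" "0 \<le> p \<bullet> q" "0 \<le> t" "t \<le> 1"
  shows "\<rho> / 2 \<le> norm ((1 - t) *\<^sub>R p + t *\<^sub>R q)"
proof -
  have "p \<bullet> p = \<rho>\<^sup>2" "q \<bullet> q = \<rho>\<^sup>2" using assms by (auto simp: dot_square_norm)
  then have "(norm ((1 - t) *\<^sub>R p + t *\<^sub>R q))\<^sup>2 = ((1-t)\<^sup>2 + t\<^sup>2) * \<rho>\<^sup>2 + 2 * t * (1-t) * (p \<bullet> q)"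
    unfolding power2_norm_eq_inner
    by (simp add: inner_add_left inner_add_right inner_commute power2_eq_square algebra_simps)
  moreover have "0 \<le> 2 * t * (1-t) * (p \<bullet> q)" using assms by simp
  moreover have "(1-t)\<^sup>2 + t\<^sup>2 = 1/2 + 2 * (t - 1/2)\<^sup>2" by (simp add: power2_eq_square algebra_simps)
  then have "1/4 * \<rho>\<^sup>2 \<le> ((1-t)\<^sup>2 + t\<^sup>2) * \<rho>\<^sup>2" by (intro mult_right_mono) auto
  ultimately have "(\<rho>/2)\<^sup>2 \<le> (norm ((1 - t) *\<^sub>R p + t *\<^sub>R q))\<^sup>2" by (simp add: power_divide)
  then show ?thesis using power2_le_imp_le norm_ge_zero by blast
qed

definition sphere_step :: "real \<Rightarrow> 'a::metric_space \<Rightarrow> real \<Rightarrow> ('a \<times> 'a) set" where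
  "sphere_step e a \<rho> = {(u, v). u \<in> sphere a \<rho> \<and> v \<in> sphere a \<rho> \<and> dist u v \<le> e * \<rho>}"

lemma sphere_chain_acute:
  fixes a p q :: "'a::euclidean_space"
  assumes \<rho>_pos: "0 < \<rho>" and e_pos: "0 < e" and p_in: "p \<in> sphere a \<rho>" and q_in: "q \<in> sphere a \<rho>"
    and acute: "0 \<le> (p - a) \<bullet> (q - a)"
  shows "(p, q) \<in> sphere_step e a \<rho> ^^ nat \<lceil>8 / e\<rceil>"
proof -
  define K where "K = nat \<lceil>8 / e\<rceil>"
  have K_ge: "8 / e \<le> real K" unfolding K_def by (rule real_nat_ceiling_ge)
  have far: "\<rho> / 2 \<le> dist a z" if z_in: "z \<in> closed_segment p q" for z
  proof -
    obtain t where convex_comb: "z = (1 - t) *\<^sub>R p + t *\<^sub>R q" "0 \<le> t" "t \<le> 1"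
      using z_in unfolding closed_segment_def by auto
    then have "z - a = (1 - t) *\<^sub>R (p - a) + t *\<^sub>R (q - a)" by (simp add: algebra_simps)
    then show ?thesis
      using norm_segment_ge[OF _ _ acute convex_comb(2,3), of \<rho>] p_in q_in
      by (simp add: dist_norm norm_minus_commute[of a])
  qed
  have "(p, q) \<in> {(z, w). (radial_proj a \<rho> z, radial_proj a \<rho> w) \<in> sphere_step e a \<rho>} ^^ K"
  proof (rule segment_chain[where e = "e * \<rho> / 4"])
    fix z w assume z_in: "z \<in> closed_segment p q" and w_in: "w \<in> closed_segment p q"
      and near: "dist z w \<le> e * \<rho> / 4"
    have not_center: "z \<noteq> a" "w \<noteq> a" using far[OF z_in] far[OF w_in] \<rho>_pos by auto
    have "dist (radial_proj a \<rho> z) (radial_proj a \<rho> w) \<le> 2 * \<rho> / dist a z * dist z w"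
      using dist_radial_proj_le[OF not_center] \<rho>_pos by simp
    also have "\<dots> \<le> 4 * dist z w"
      using far[OF z_in] not_center \<rho>_pos by (intro mult_right_mono) (auto simp: pos_divide_le_eq)
    finally show "(z, w) \<in> {(z, w). (radial_proj a \<rho> z, radial_proj a \<rho> w) \<in> sphere_step e a \<rho>}"
      using radial_proj_in_sphere not_center \<rho>_pos near unfolding sphere_step_def by force
  next
    have "dist p q \<le> 2 * \<rho>" using p_in q_in dist_triangle[of p q a] by (simp add: dist_commute)
    also have "\<dots> \<le> real K * (e * \<rho> / 4)"
      using K_ge e_pos \<rho>_pos by (simp add: field_simps)
    finally show "dist p q \<le> real K * (e * \<rho> / 4)" .
    show "0 < K" using e_pos unfolding K_def by simp
  qed
  then have "(radial_proj a \<rho> p, radial_proj a \<rho> q) \<in> sphere_step e a \<rho> ^^ (K * 1)"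
    by (rule relpow_map[rotated]) simp
  moreover have "radial_proj a \<rho> p = p" "radial_proj a \<rho> q = q"
    using p_in q_in \<rho>_pos by (auto intro!: radial_proj_sphere)
  ultimately show ?thesis unfolding K_def by simp
qed

lemma sphere_chain:
  fixes a p q :: "'a::euclidean_space"
  assumes dim: "2 \<le> DIM('a)" and \<rho>_pos: "0 < \<rho>" and e_pos: "0 < e"
    and p_in: "p \<in> sphere a \<rho>" and q_in: "q \<in> sphere a \<rho>"
  shows "(p, q) \<in> sphere_step e a \<rho> ^^ (2 * nat \<lceil>8 / e\<rceil>)"
proof -
  obtain y where y_orth: "y \<noteq> 0" "orthogonal (p - a) y"
    using orthogonal_to_vector_exists[OF dim] by blast
  define w where "w = (if 0 \<le> y \<bullet> (q - a) then \<rho> / norm y else - \<rho> / norm y) *\<^sub>R y"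
  have w_orth: "norm w = \<rho>" "(p - a) \<bullet> w = 0"
    using y_orth \<rho>_pos unfolding w_def orthogonal_def by auto
  have "0 \<le> w \<bullet> (q - a)"
    using y_orth \<rho>_pos unfolding w_def by (auto simp: divide_simps mult_nonneg_nonpos)
  then have "(a + w, q) \<in> sphere_step e a \<rho> ^^ nat \<lceil>8 / e\<rceil>"
    by (intro sphere_chain_acute[OF \<rho>_pos e_pos _ q_in]) (use w_orth in \<open>auto simp: dist_norm\<close>)
  moreover have "(p, a + w) \<in> sphere_step e a \<rho> ^^ nat \<lceil>8 / e\<rceil>"
    by (rule sphere_chain_acute[OF \<rho>_pos e_pos p_in]) (use w_orth in \<open>auto simp: dist_norm\<close>)
  ultimately show ?thesis using relpow_trans by (metis mult_2)
qed

lemma sphere_chain_step: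
  fixes a p q :: "'a::euclidean_space"
  assumes "2 \<le> DIM('a)" "0 < \<rho>" "0 < e" "p \<in> sphere a \<rho>" "q \<in> sphere a \<rho>"
    and sphere: "sphere a \<rho> \<subseteq> G" "\<And>z. z \<in> sphere a \<rho> \<Longrightarrow> e * \<rho> \<le> l * codist G z"
  shows "(p, q) \<in> chain_step l G ^^ (2 * nat \<lceil>8 / e\<rceil>)"
proof (rule relpowp_mono[to_set, OF _ sphere_chain[OF assms(1-5)]])
  show "(u, v) \<in> chain_step l G" if "(u, v) \<in> sphere_step e a \<rho>" for u v
  proof -
    have step: "u \<in> sphere a \<rho>" "v \<in> sphere a \<rho>" "dist u v \<le> e * \<rho>"
      using that unfolding sphere_step_def by auto
    then have "dist u v \<le> l * codist G u" "dist u v \<le> l * codist G v"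
      using sphere(2) order_trans by blast+
    then show ?thesis using step(1,2) sphere(1) unfolding chain_step_def by blast
  qed
qed

lemma punctured_chain_uniform:
  fixes a :: "'a::euclidean_space"
  assumes dim: "2 \<le> DIM('a)"
  shows "chain_uniform (\<lambda>t. Suc (nat \<lceil>2 * t\<rceil>) + 32) (- {a})"
  unfolding chain_uniform_def
proof (intro ballI allI impI)
  have codist: "codist (- {a}) z = dist a z" for z unfolding codist_def by (simp add: dist_commute)
  fix x y t assume x_ne: "x \<in> - {a}" and y_ne: "y \<in> - {a}"
    and ratio: "dist x y \<le> t * codist (- {a}) x" "dist x y \<le> t * codist (- {a}) y"
  have pos: "0 < dist a x" "0 < dist a y" using x_ne y_ne by auto
  define m where "m = min (dist a x) (dist a y)"
  define p where "p = radial_proj a (dist a y) x"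
  have p_proj: "p \<in> sphere a (dist a y)" "dist x p = \<bar>dist a x - dist a y\<bar>"
    unfolding p_def using x_ne
    by (auto simp: dist_radial_proj simp del: mem_sphere intro: radial_proj_in_sphere)
  have m_le: "0 < m" "m \<le> dist a z" if "z \<in> closed_segment x p" for z
    using pos dist_in_closed_segment[OF that] p_proj dist_triangle[of a x z] dist_triangle[of a p z]
    unfolding m_def by (auto simp: dist_commute min_def abs_if split: if_splits)
  have "dist x p \<le> dist x y"
    using p_proj(2) dist_triangle[of a x y] dist_triangle[of a y x] by (simp add: dist_commute)
  also have "\<dots> \<le> t * m" using ratio unfolding m_def codist by (simp add: min_def)
  also have "\<dots> \<le> real (Suc (nat \<lceil>2 * t\<rceil>)) / 2 * m"
    using m_le(1)[of x] real_nat_ceiling_ge[of "2 * t"] by (intro mult_right_mono) auto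
  finally have "dist x p \<le> real (Suc (nat \<lceil>2 * t\<rceil>)) * (m / 2)" by simp
  then have "(x, p) \<in> chain_step (1/2) (- {a}) ^^ Suc (nat \<lceil>2 * t\<rceil>)"
  proof (rule segment_chain[rotated])
    fix z w assume "z \<in> closed_segment x p" "w \<in> closed_segment x p" "dist z w \<le> m / 2"
    then show "(z, w) \<in> chain_step (1/2) (- {a})"
      using m_le[of z] m_le[of w] unfolding chain_step_def codist by auto
  qed simp
  moreover have "(p, y) \<in> chain_step (1/2) (- {a}) ^^ (2 * nat \<lceil>8 / (1/2 :: real)\<rceil>)"
    by (rule sphere_chain_step[OF dim pos(2)]) (use p_proj pos in \<open>auto simp: codist\<close>)
  then have "(p, y) \<in> chain_step (1/2) (- {a}) ^^ 32" by simp
  ultimately show "(x, y) \<in> chain_step (1/2) (- {a}) ^^ (Suc (nat \<lceil>2 * t\<rceil>) + 32)"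
    by (rule relpow_trans)
qed

section \<open>Detours around separated sets\<close>

lemma closest_point_frontier:
  fixes H :: "'a::euclidean_space set"
  assumes "u \<notin> H" "v \<in> H"
  shows "closest_point (frontier H) v \<in> frontier H"
    and "dist v (closest_point (frontier H) v) \<le> dist u v"
proof -
  obtain p where crossing: "p \<in> closed_segment v u" "p \<in> frontier H"
    using connected_Int_frontier[of "closed_segment v u" H] assms by auto
  then show "closest_point (frontier H) v \<in> frontier H" by (intro closest_point_in_set) auto
  have "dist v (closest_point (frontier H) v) \<le> dist v p"
    by (rule closest_point_le[OF frontier_closed crossing(2)])
  also have "\<dots> \<le> dist u v" using dist_in_closed_segment[OF crossing(1)] by (simp add: dist_commute)
  finally show "dist v (closest_point (frontier H) v) \<le> dist u v" .
qed

definition push_out :: "'i set \<Rightarrow> ('i \<Rightarrow> 'a::euclidean_space set) \<Rightarrow> 'a \<Rightarrow> 'a" where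
  "push_out I H z =
     (if z \<in> (\<Union>i\<in>I. H i) then closest_point (frontier (H (SOME i. i \<in> I \<and> z \<in> H i))) z else z)"

lemma push_out_outside: "z \<notin> (\<Union>i\<in>I. H i) \<Longrightarrow> push_out I H z = z"
  unfolding push_out_def by simp

lemma push_out_insideE:
  assumes "z \<in> (\<Union>i\<in>I. H i)"
  obtains i where "i \<in> I" "z \<in> H i" "push_out I H z = closest_point (frontier (H i)) z"
  using that assms someI_ex[of "\<lambda>i. i \<in> I \<and> z \<in> H i"] unfolding push_out_def by auto

context
  fixes X G :: "'a::euclidean_space set" and I :: "'i set" and H :: "'i \<Rightarrow> 'a set"
    and l :: real and K :: nat
  assumes outside: "\<And>z. z \<in> X \<Longrightarrow> z \<notin> (\<Union>i\<in>I. H i) \<Longrightarrow> z \<in> G \<and> 4 * l * codist X z \<le> codist G z"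
    and boundary: "\<And>i u v p. i \<in> I \<Longrightarrow> u \<in> X - H i \<Longrightarrow> v \<in> X \<inter> H i \<Longrightarrow> p \<in> frontier (H i) \<Longrightarrow>
      p \<in> G \<and> 4 * l * min (codist X u) (codist X v) \<le> codist G p"
    and linked: "\<And>i p q. i \<in> I \<Longrightarrow> p \<in> frontier (H i) \<Longrightarrow> q \<in> frontier (H i) \<Longrightarrow>
      (p, q) \<in> chain_step (1/2) G ^^ K"
    and separated: "\<And>i j u v. i \<in> I \<Longrightarrow> j \<in> I \<Longrightarrow> u \<in> H i \<Longrightarrow> v \<in> H j \<Longrightarrow>
      (u, v) \<in> chain_step l X \<Longrightarrow> i = j"
    and proper: "\<And>i. i \<in> I \<Longrightarrow> H i \<noteq> UNIV"
    and K_pos: "1 \<le> K"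
begin

lemma detour_step_outside:
  assumes step: "(u, v) \<in> chain_step l X" and "u \<notin> (\<Union>i\<in>I. H i)" "v \<notin> (\<Union>i\<in>I. H i)"
  shows "(u, v) \<in> chain_step (1/2) G ^^ K"
proof -
  have small: "u \<in> X" "v \<in> X" "dist u v \<le> l * codist X u" "dist u v \<le> l * codist X v"
    using step unfolding chain_step_def by auto
  have in_G: "u \<in> G" "v \<in> G" "4 * l * codist X u \<le> codist G u" "4 * l * codist X v \<le> codist G v"
    using outside small(1,2) assms(2,3) by blast+
  then have "dist u v \<le> 1/2 * codist G u" "dist u v \<le> 1/2 * codist G v"
    using small(3,4) zero_le_dist[of u v] by linarith+
  then have "(u, v) \<in> chain_step (1/2) G ^^ 1" using in_G unfolding chain_step_def by simp
  then show ?thesis by (rule chain_pad) (use in_G K_pos in auto)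
qed

lemma detour_step_into_hole:
  assumes step: "(u, v) \<in> chain_step l X" and u_out: "u \<notin> (\<Union>i\<in>I. H i)" and v_in: "v \<in> (\<Union>i\<in>I. H i)"
  shows "(u, push_out I H v) \<in> chain_step (1/2) G ^^ K"
proof -
  obtain i where hole: "i \<in> I" "v \<in> H i" "push_out I H v = closest_point (frontier (H i)) v"
    using v_in by (rule push_out_insideE)
  define p where "p = push_out I H v"
  have small: "u \<in> X" "v \<in> X" "dist u v \<le> l * codist X u" "dist u v \<le> l * codist X v"
    using step unfolding chain_step_def by auto
  have u_notin: "u \<notin> H i" using u_out hole(1) by blast
  have p_frontier: "p \<in> frontier (H i)" "dist v p \<le> dist u v"
    unfolding p_def hole(3) by (fact closest_point_frontier[OF u_notin hole(2)])+
  then have "dist u p \<le> 2 * dist u v" using dist_triangle[of u p v] by linarith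
  moreover have u_in_G: "u \<in> G" "4 * l * codist X u \<le> codist G u"
    using outside small(1) u_out by blast+
  moreover have p_in_G: "p \<in> G" "4 * l * min (codist X u) (codist X v) \<le> codist G p"
    using boundary[OF hole(1), of u v p] small(1,2) u_notin hole(2) p_frontier(1) by blast+
  moreover have "dist u v \<le> l * min (codist X u) (codist X v)"
    using small(3,4) by (simp add: min_def)
  ultimately have "dist u p \<le> 1/2 * codist G u" "dist u p \<le> 1/2 * codist G p"
    using small(3) by linarith+
  then have "(u, p) \<in> chain_step (1/2) G ^^ 1"
    using u_in_G(1) p_in_G(1) unfolding chain_step_def by simp
  then show ?thesis unfolding p_def[symmetric] by (rule chain_pad) (use p_in_G K_pos in auto)
qed

lemma detour_step:
  assumes step: "(u, v) \<in> chain_step l X"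
  shows "(push_out I H u, push_out I H v) \<in> chain_step (1/2) G ^^ K"
proof (cases "u \<in> (\<Union>i\<in>I. H i)"; cases "v \<in> (\<Union>i\<in>I. H i)")
  assume u_in: "u \<in> (\<Union>i\<in>I. H i)" and v_in: "v \<in> (\<Union>i\<in>I. H i)"
  obtain i where hole_u: "i \<in> I" "u \<in> H i" "push_out I H u = closest_point (frontier (H i)) u"
    using u_in by (rule push_out_insideE)
  obtain j where hole_v: "j \<in> I" "v \<in> H j" "push_out I H v = closest_point (frontier (H j)) v"
    using v_in by (rule push_out_insideE)
  have "j = i" using separated[OF hole_u(1) hole_v(1) hole_u(2) hole_v(2) step] by simp
  obtain z where "z \<notin> H i" using proper[OF hole_u(1)] by blast
  from closest_point_frontier(1)[OF this] show ?thesis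
    unfolding hole_u(3) hole_v(3) \<open>j = i\<close> using hole_u(1,2) hole_v(2) \<open>j = i\<close> by (intro linked) auto
next
  assume u_in: "u \<in> (\<Union>i\<in>I. H i)" and v_out: "v \<notin> (\<Union>i\<in>I. H i)"
  show ?thesis
    unfolding push_out_outside[OF v_out]
    by (rule chain_sym[OF detour_step_into_hole[OF chain_step_sym[OF step] v_out u_in]])
next
  assume u_out: "u \<notin> (\<Union>i\<in>I. H i)" and v_in: "v \<in> (\<Union>i\<in>I. H i)"
  show ?thesis
    unfolding push_out_outside[OF u_out] by (rule detour_step_into_hole[OF step u_out v_in])
next
  assume u_out: "u \<notin> (\<Union>i\<in>I. H i)" and v_out: "v \<notin> (\<Union>i\<in>I. H i)"
  show ?thesis
    unfolding push_out_outside[OF u_out] push_out_outside[OF v_out]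
    by (rule detour_step_outside[OF step u_out v_out])
qed

lemma chain_detour:
  assumes "x \<in> X - (\<Union>i\<in>I. H i)" "y \<in> X - (\<Union>i\<in>I. H i)" and "(x, y) \<in> chain_step l X ^^ n"
  shows "(x, y) \<in> chain_step (1/2) G ^^ (n * K)"
proof -
  have "(push_out I H x, push_out I H y) \<in> chain_step (1/2) G ^^ (n * K)"
    using detour_step assms(3) by (rule relpow_map)
  then show ?thesis using assms(1,2) by (auto simp: push_out_outside)
qed

end

section \<open>Removing separated sets\<close>

text \<open>A chain is refined to relative step size \<open>\<eta>\<^sup>2/8\<close>, so that no step passes from one hole to another;
  each refined step is replaced by at most a walk along a sphere.\<close>

definition detour_cost :: "real \<Rightarrow> nat" where
  "detour_cost \<eta> = nat \<lceil>8 / \<eta>\<^sup>2\<rceil> * (2 * nat \<lceil>16 / \<eta>\<rceil>)"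

definition removal_bound :: "real \<Rightarrow> (real \<Rightarrow> nat) \<Rightarrow> (real \<Rightarrow> nat) \<Rightarrow> real \<Rightarrow> nat" where
  "removal_bound \<eta> f g t = (g t + (g (2*t/\<eta>) + f (2*t/\<eta>) + g (2*t/\<eta>))) * detour_cost \<eta>"

locale hole_system =
  fixes \<eta> :: real and D :: "'a::euclidean_space set" and I :: "'i set"
    and a :: "'i \<Rightarrow> 'a" and R :: "'i \<Rightarrow> real" and E :: "'i \<Rightarrow> 'a set"
  assumes dim: "2 \<le> DIM('a)"
    and eta_pos: "0 < \<eta>" and eta_le_1: "\<eta> \<le> 1"
    and open_D: "open D" and D_not_UNIV: "D \<noteq> UNIV"
    and R_pos: "i \<in> I \<Longrightarrow> 0 < R i"
    and closed_E: "i \<in> I \<Longrightarrow> closed (E i)" and E_nonempty: "i \<in> I \<Longrightarrow> E i \<noteq> {}"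
    and margin: "i \<in> I \<Longrightarrow> w \<in> E i \<Longrightarrow> dist (a i) w \<le> (1 - \<eta>) * R i"
    and depth: "i \<in> I \<Longrightarrow> z \<in> cball (a i) (R i) \<Longrightarrow> \<eta> * R i \<le> codist D z"
    and width: "i \<in> I \<Longrightarrow> z \<in> ball (a i) (R i) \<Longrightarrow> \<eta> * codist D z \<le> R i"
    and separated: "i \<in> I \<Longrightarrow> j \<in> I \<Longrightarrow> i \<noteq> j \<Longrightarrow> z \<in> cball (a i) (R i) \<Longrightarrow> w \<in> cball (a j) (R j) \<Longrightarrow>
      \<eta> * R i \<le> dist z w"
begin

abbreviation G :: "'a set" where "G \<equiv> D - (\<Union>i\<in>I. E i)"

abbreviation outer :: "'a set" where "outer \<equiv> D - (\<Union>i\<in>I. ball (a i) (R i))"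

lemma eta_R_pos: "i \<in> I \<Longrightarrow> 0 < \<eta> * R i"
  using eta_pos R_pos by simp

lemma E_subset_ball: "i \<in> I \<Longrightarrow> E i \<subseteq> ball (a i) (R i)"
  using margin eta_R_pos by (force simp: algebra_simps)

lemma outer_subset_G: "outer \<subseteq> G"
  using E_subset_ball by blast

lemma cball_disjoint:
  assumes "i \<in> I" "j \<in> I" "z \<in> cball (a i) (R i)" "z \<in> cball (a j) (R j)"
  shows "i = j"
  using separated[OF assms(1,2) _ assms(3,4)] eta_R_pos[OF assms(1)] by fastforce

lemma cball_subset_D: "i \<in> I \<Longrightarrow> cball (a i) (R i) \<subseteq> D"
proof
  fix z assume "i \<in> I" "z \<in> cball (a i) (R i)"
  then have "0 < codist D z" using depth eta_R_pos by fastforce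
  then show "z \<in> D" using codist_le[of z D z] by force
qed

lemma cball_minus_E_subset_G:
  assumes "i \<in> I" shows "cball (a i) (R i) - E i \<subseteq> G"
proof
  fix z assume z_in: "z \<in> cball (a i) (R i) - E i"
  have "z \<notin> E j" if "j \<in> I" for j
    using cball_disjoint[OF assms that] E_subset_ball[OF that] z_in ball_subset_cball by blast
  then show "z \<in> G" using z_in cball_subset_D[OF assms] by blast
qed

lemma sphere_subset_outer:
  assumes "i \<in> I" shows "sphere (a i) (R i) \<subseteq> outer"
proof
  fix z assume z_in: "z \<in> sphere (a i) (R i)"
  then have "z \<in> cball (a i) (R i)" by simp
  then have "z \<notin> ball (a j) (R j)" if "j \<in> I" for j
    using cball_disjoint[OF assms that] z_in ball_subset_cball by fastforce
  then show "z \<in> outer" using \<open>z \<in> cball (a i) (R i)\<close> cball_subset_D[OF assms] by blast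
qed

lemma sphere_subset_G: "i \<in> I \<Longrightarrow> sphere (a i) (R i) \<subseteq> G"
  using sphere_subset_outer outer_subset_G by blast

lemma G_nonempty: "I \<noteq> {} \<Longrightarrow> G \<noteq> {}"
  using sphere_subset_G R_pos by (fastforce simp flip: ex_in_conv)

lemma infdist_E_le:
  assumes i_in: "i \<in> I" and z_in: "z \<in> cball (a i) (R i)" shows "infdist z (E i) \<le> 2 * R i"
proof -
  obtain e where e_in: "e \<in> E i" using E_nonempty[OF i_in] by blast
  then have "dist (a i) e < R i" using E_subset_ball[OF i_in] by auto
  then have "dist z e \<le> 2 * R i" using z_in dist_triangle[of z e "a i"] by (simp add: dist_commute)
  then show ?thesis using infdist_le2[OF e_in] by blast
qed

lemma codist_G_le_infdist: "i \<in> I \<Longrightarrow> codist G z \<le> infdist z (E i)"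
  using codist_mono[of G "- E i" z] E_nonempty[of i] unfolding codist_def by auto

lemma codist_G_le_codist_D: "codist G z \<le> codist D z"
  by (rule codist_mono[OF _ D_not_UNIV]) blast

lemma codist_G_ge:
  assumes "\<And>w. w \<notin> D \<Longrightarrow> \<rho> \<le> dist z w" "\<And>i w. i \<in> I \<Longrightarrow> w \<in> E i \<Longrightarrow> \<rho> \<le> dist z w"
  shows "\<rho> \<le> codist G z"
  using assms D_not_UNIV by (intro codist_ge) auto

lemma codist_G_hole:
  assumes i_in: "i \<in> I" and z_in: "z \<in> cball (a i) (R i)"
  shows "min (infdist z (E i)) (\<eta> * R i) \<le> codist G z"
proof (rule codist_G_ge)
  show "min (infdist z (E i)) (\<eta> * R i) \<le> dist z w" if "w \<notin> D" for w
    using depth[OF i_in z_in] codist_le[OF that, of z] by linarith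
  show "min (infdist z (E i)) (\<eta> * R i) \<le> dist z w" if w_in: "j \<in> I" "w \<in> E j" for j w
  proof (cases "j = i")
    case True
    then show ?thesis using infdist_le[OF w_in(2), of z] by simp
  next
    case False
    have "w \<in> cball (a j) (R j)" using E_subset_ball[OF w_in(1)] w_in(2) ball_subset_cball by blast
    from separated[OF i_in w_in(1) False[symmetric] z_in this] show ?thesis by linarith
  qed
qed

lemma codist_G_sphere:
  assumes i_in: "i \<in> I" and z_in: "z \<in> sphere (a i) (R i)"
  shows "\<eta> * R i \<le> codist G z"
proof -
  have "\<eta> * R i \<le> infdist z (E i)"
    unfolding infdist_notempty[OF E_nonempty[OF i_in]]
  proof (rule cINF_greatest[OF E_nonempty[OF i_in]])
    fix w assume "w \<in> E i"
    from margin[OF i_in this] show "\<eta> * R i \<le> dist z w"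
      using z_in dist_triangle[of "a i" z w] by (simp add: dist_commute algebra_simps)
  qed
  then show ?thesis using codist_G_hole[OF i_in, of z] z_in by simp
qed

lemma codist_G_inside:
  assumes i_in: "i \<in> I" and z_in: "z \<in> cball (a i) (R i)"
  shows "\<eta>\<^sup>2 / 2 * infdist z (E i) \<le> codist G z"
proof -
  have "\<eta>\<^sup>2 \<le> \<eta>" using eta_pos eta_le_1 by (simp add: power2_eq_square)
  have "\<eta>\<^sup>2 / 2 * infdist z (E i) \<le> 1 * infdist z (E i)"
    using \<open>\<eta>\<^sup>2 \<le> \<eta>\<close> eta_pos eta_le_1 by (intro mult_right_mono) (auto simp: infdist_nonneg)
  moreover have "\<eta>\<^sup>2 / 2 * infdist z (E i) \<le> \<eta> / 2 * (2 * R i)"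
    using \<open>\<eta>\<^sup>2 \<le> \<eta>\<close> eta_pos eta_le_1 infdist_E_le[OF i_in z_in]
    by (intro mult_mono) (auto simp: infdist_nonneg)
  ultimately show ?thesis using codist_G_hole[OF i_in z_in] by simp
qed

lemma codist_G_outer:
  assumes z_in: "z \<in> outer"
  shows "\<eta>\<^sup>2 / 2 * codist D z \<le> codist G z"
proof (rule codist_G_ge)
  have \<eta>_square_le: "\<eta>\<^sup>2 \<le> 1" using eta_pos eta_le_1 by (simp add: power_le_one)
  show "\<eta>\<^sup>2 / 2 * codist D z \<le> dist z w" if "w \<notin> D" for w
  proof -
    have "\<eta>\<^sup>2 / 2 * codist D z \<le> 1 * codist D z" using \<eta>_square_le by (intro mult_right_mono) auto
    then show ?thesis using codist_le[OF that, of z] by linarith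
  qed
  show "\<eta>\<^sup>2 / 2 * codist D z \<le> dist z w" if i_in: "i \<in> I" and w_in: "w \<in> E i" for i w
  proof -
    have "R i \<le> dist (a i) z" using z_in i_in by force
    then have far: "\<eta> * R i \<le> dist z w"
      using margin[OF i_in w_in] dist_triangle[of "a i" z w]
      by (simp add: dist_commute algebra_simps)
    have "\<eta> * codist D w \<le> R i" using width[OF i_in] E_subset_ball[OF i_in] w_in by blast
    then have "\<eta> * (\<eta> * codist D w) \<le> \<eta> * R i" using eta_pos by (intro mult_left_mono) auto
    moreover have "\<eta>\<^sup>2 * codist D z \<le> \<eta>\<^sup>2 * (codist D w + dist z w)"
      by (intro mult_left_mono codist_triangle) simp
    moreover have "\<eta>\<^sup>2 * dist z w \<le> 1 * dist z w" using \<eta>_square_le by (intro mult_right_mono) auto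
    ultimately show ?thesis using far by (simp add: power2_eq_square algebra_simps)
  qed
qed

lemma codist_G_pos:
  assumes "z \<in> G" shows "0 < codist G z"
proof (cases "z \<in> outer")
  case True
  then have "0 < \<eta>\<^sup>2 / 2 * codist D z" using eta_pos codist_pos[OF open_D D_not_UNIV] by simp
  then show ?thesis using codist_G_outer[OF True] by linarith
next
  case False
  then obtain i where in_ball: "i \<in> I" "z \<in> ball (a i) (R i)" using assms by blast
  then have "0 < infdist z (E i)"
    using assms closed_E E_nonempty by (intro infdist_pos_not_in_closed) auto
  then show ?thesis using codist_G_hole[OF in_ball(1), of z] in_ball(2) eta_R_pos[OF in_ball(1)]
    by auto
qed

lemma open_G: "open G"
  by (rule open_if_codist_pos) (rule codist_G_pos)

lemma sphere_linked:
  assumes i_in: "i \<in> I" and p_in: "p \<in> sphere (a i) (R i)" and q_in: "q \<in> sphere (a i) (R i)"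
  shows "(p, q) \<in> chain_step (1/2) G ^^ (2 * nat \<lceil>16 / \<eta>\<rceil>)"
proof -
  have "(p, q) \<in> chain_step (1/2) G ^^ (2 * nat \<lceil>8 / (\<eta>/2)\<rceil>)"
    by (rule sphere_chain_step[OF dim R_pos[OF i_in] _ p_in q_in sphere_subset_G[OF i_in]])
      (use eta_pos codist_G_sphere[OF i_in] in auto)
  then show ?thesis by simp
qed

lemma linking_number_pos: "1 \<le> 2 * nat \<lceil>16 / \<eta>\<rceil>"
proof -
  have "0 < 16 / \<eta>" using eta_pos by simp
  then show ?thesis by linarith
qed

lemma chain_refine_eta:
  "(x, y) \<in> chain_step (1/2) X ^^ n \<Longrightarrow> (x, y) \<in> chain_step (\<eta>\<^sup>2/8) X ^^ (n * nat \<lceil>8 / \<eta>\<^sup>2\<rceil>)"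
  for x y :: 'a
  using chain_refine[where l = "\<eta>\<^sup>2/8"] eta_pos by fastforce

lemma chain_outside:
  assumes chain_D: "chain_uniform f D" and x_in: "x \<in> outer" and y_in: "y \<in> outer"
    and ratio: "dist x y \<le> t * codist G x" "dist x y \<le> t * codist G y" and t_nonneg: "0 \<le> t"
  shows "(x, y) \<in> chain_step (1/2) G ^^ (f t * detour_cost \<eta>)"
  unfolding detour_cost_def mult.assoc[symmetric, of "f t"]
proof (rule chain_detour[where H = "\<lambda>i. ball (a i) (R i)"])
  have "t * codist G z \<le> t * codist D z" for z
    using codist_G_le_codist_D t_nonneg by (rule mult_left_mono)
  then have "(x, y) \<in> chain_step (1/2) D ^^ f t"
    using x_in y_in ratio by (intro chain_uniformD[OF chain_D]) (auto intro: order_trans)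
  then show "(x, y) \<in> chain_step (\<eta>\<^sup>2/8) D ^^ (f t * nat \<lceil>8 / \<eta>\<^sup>2\<rceil>)" by (rule chain_refine_eta)
  show "z \<in> G \<and> 4 * (\<eta>\<^sup>2/8) * codist D z \<le> codist G z" if "z \<in> D" "z \<notin> (\<Union>i\<in>I. ball (a i) (R i))" for z
    using codist_G_outer[of z] outer_subset_G that by auto
  show "p \<in> G \<and> 4 * (\<eta>\<^sup>2/8) * min (codist D u) (codist D v) \<le> codist G p"
    if i_in: "i \<in> I" and v_in: "v \<in> D \<inter> ball (a i) (R i)"
      and p_in: "p \<in> frontier (ball (a i) (R i))" for i u v p
  proof -
    have p_in: "p \<in> sphere (a i) (R i)" using p_in R_pos[OF i_in] by simp
    have "4 * (\<eta>\<^sup>2/8) * min (codist D u) (codist D v) \<le> \<eta>\<^sup>2 * codist D v"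
      by (intro mult_mono) auto
    also have "\<dots> \<le> \<eta> * R i"
      using width[OF i_in, of v] v_in eta_pos unfolding power2_eq_square mult.assoc
      by (intro mult_left_mono) auto
    also have "\<dots> \<le> codist G p" by (rule codist_G_sphere[OF i_in p_in])
    finally show ?thesis using sphere_subset_G[OF i_in] p_in by blast
  qed
  show "i = j" if ij_in: "i \<in> I" "j \<in> I" and u_in: "u \<in> ball (a i) (R i)"
    and v_in: "v \<in> ball (a j) (R j)"
    and step: "(u, v) \<in> chain_step (\<eta>\<^sup>2/8) D" for i j u v
  proof (rule ccontr)
    assume "i \<noteq> j"
    then have "\<eta> * R i \<le> dist u v" using separated[OF ij_in, of u v] u_in v_in by auto
    also have "dist u v \<le> \<eta>/8 * (\<eta> * codist D u)"
      using step unfolding chain_step_def by (auto simp: power2_eq_square)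
    also have "\<dots> \<le> \<eta>/8 * R i" using width[OF ij_in(1) u_in] eta_pos by (intro mult_left_mono) auto
    finally show False using eta_R_pos[OF ij_in(1)] by simp
  qed
  show "ball (a i) (R i) \<noteq> UNIV" for i using bounded_ball not_bounded_UNIV by metis
qed (use x_in y_in sphere_linked linking_number_pos R_pos in auto)

lemma chain_inside:
  assumes i_in: "i \<in> I" and chain_E: "chain_uniform g (- E i)"
    and x_in: "x \<in> G \<inter> cball (a i) (R i)" and y_in: "y \<in> G \<inter> cball (a i) (R i)"
    and ratio: "dist x y \<le> t * codist G x" "dist x y \<le> t * codist G y" and t_nonneg: "0 \<le> t"
  shows "(x, y) \<in> chain_step (1/2) G ^^ (g t * detour_cost \<eta>)"
  unfolding detour_cost_def mult.assoc[symmetric, of "g t"]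
proof (rule chain_detour[where X = "- E i" and H = "\<lambda>_. - cball (a i) (R i)" and I = "{()}"])
  have codist: "codist (- E i) z = infdist z (E i)" for z unfolding codist_def by simp
  have "t * codist G z \<le> t * codist (- E i) z" for z
    unfolding codist using codist_G_le_infdist[OF i_in] t_nonneg by (rule mult_left_mono)
  then have "(x, y) \<in> chain_step (1/2) (- E i) ^^ g t"
    using x_in y_in ratio i_in by (intro chain_uniformD[OF chain_E]) (auto intro: order_trans)
  then show "(x, y) \<in> chain_step (\<eta>\<^sup>2/8) (- E i) ^^ (g t * nat \<lceil>8 / \<eta>\<^sup>2\<rceil>)" by (rule chain_refine_eta)
  show "z \<in> G \<and> 4 * (\<eta>\<^sup>2/8) * codist (- E i) z \<le> codist G z"
    if "z \<in> - E i" "z \<notin> (\<Union>j\<in>{()}. - cball (a i) (R i))" for z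
    using codist_G_inside[OF i_in, of z] cball_minus_E_subset_G[OF i_in] that codist by auto
  show "p \<in> G \<and> 4 * (\<eta>\<^sup>2/8) * min (codist (- E i) u) (codist (- E i) v) \<le> codist G p"
    if u_in: "u \<in> - E i - (- cball (a i) (R i))" and p_in: "p \<in> frontier (- cball (a i) (R i))" for u v p
  proof -
    have p_in: "p \<in> sphere (a i) (R i)" using p_in by simp
    have "4 * (\<eta>\<^sup>2/8) * min (codist (- E i) u) (codist (- E i) v) \<le> \<eta>\<^sup>2/2 * infdist u (E i)"
      by (intro mult_mono) (auto simp: codist infdist_nonneg)
    also have "\<dots> \<le> \<eta>\<^sup>2/2 * (2 * R i)"
      using infdist_E_le[OF i_in, of u] u_in by (intro mult_left_mono) auto
    also have "\<dots> \<le> \<eta> * R i" using eta_pos eta_le_1 R_pos[OF i_in] by (simp add: power2_eq_square)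
    also have "\<dots> \<le> codist G p" by (rule codist_G_sphere[OF i_in p_in])
    finally show ?thesis using sphere_subset_G[OF i_in] p_in by blast
  qed
  show "(p, q) \<in> chain_step (1/2) G ^^ (2 * nat \<lceil>16 / \<eta>\<rceil>)"
    if "p \<in> frontier (- cball (a i) (R i))" "q \<in> frontier (- cball (a i) (R i))" for p q
    using sphere_linked[OF i_in] that by simp
  have "a i \<in> cball (a i) (R i)" using R_pos[OF i_in] by simp
  then show "- cball (a i) (R i) \<noteq> UNIV" by blast
qed (use x_in y_in i_in linking_number_pos in auto)

lemma escape_hole:
  assumes chain_E: "\<And>i. i \<in> I \<Longrightarrow> chain_uniform g (- E i)"
    and x_in: "x \<in> G" and y_out: "\<And>i. i \<in> I \<Longrightarrow> x \<in> ball (a i) (R i) \<Longrightarrow> y \<notin> ball (a i) (R i)"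
    and ratio: "dist x y \<le> t * codist G x" and t_nonneg: "0 \<le> t"
  obtains z where "z \<in> closed_segment x y" "z \<in> outer" "codist G x \<le> 2/\<eta> * codist G z"
    "(x, z) \<in> chain_step (1/2) G ^^ (g (2*t/\<eta>) * detour_cost \<eta>)"
proof (cases "x \<in> outer")
  case True
  have "(x, x) \<in> chain_step (1/2) G ^^ (g (2*t/\<eta>) * detour_cost \<eta>)"
    by (rule chain_pad[where m = 0]) (use x_in in auto)
  moreover have "1 * codist G x \<le> 2/\<eta> * codist G x"
    using eta_pos eta_le_1 by (intro mult_right_mono) (auto simp: pos_le_divide_eq)
  ultimately show ?thesis using True by (intro that) auto
next
  case False
  then obtain i where in_ball: "i \<in> I" "x \<in> ball (a i) (R i)" using x_in by blast
  have "closed_segment x y \<inter> frontier (ball (a i) (R i)) \<noteq> {}"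
    by (rule connected_Int_frontier) (use y_out in_ball in auto)
  then obtain z where exit: "z \<in> closed_segment x y" "z \<in> sphere (a i) (R i)"
    using R_pos[OF in_ball(1)] by auto
  have "codist G x \<le> 2 * R i"
    using codist_G_le_infdist[OF in_ball(1), of x] infdist_E_le[OF in_ball(1), of x] in_ball(2)
    by simp
  moreover have "2 * R i \<le> 2/\<eta> * codist G z"
    using codist_G_sphere[OF in_ball(1) exit(2)] eta_pos by (simp add: field_simps)
  ultimately have comparable: "codist G x \<le> 2/\<eta> * codist G z" by linarith
  have "1 * codist G x \<le> 2/\<eta> * codist G x"
    using eta_pos eta_le_1 by (intro mult_right_mono) (auto simp: pos_le_divide_eq)
  then have "t * codist G x \<le> t * (2/\<eta> * codist G z)" "t * codist G x \<le> t * (2/\<eta> * codist G x)"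
    using comparable t_nonneg by (auto intro!: mult_left_mono simp del: times_divide_eq_left)
  moreover have "dist x z \<le> dist x y"
    using dist_in_closed_segment[OF exit(1)] by (simp add: dist_commute)
  ultimately have "dist x z \<le> 2*t/\<eta> * codist G x" "dist x z \<le> 2*t/\<eta> * codist G z"
    using ratio by (simp_all add: mult_ac)
  then have "(x, z) \<in> chain_step (1/2) G ^^ (g (2*t/\<eta>) * detour_cost \<eta>)"
    using x_in in_ball exit(2) sphere_subset_G[OF in_ball(1)] t_nonneg eta_pos
    by (intro chain_inside[OF in_ball(1) chain_E[OF in_ball(1)]]) auto
  then show ?thesis using that exit sphere_subset_outer[OF in_ball(1)] comparable by blast
qed

theorem chain_uniform_remove_holes:
  assumes chain_D: "chain_uniform f D" and chain_E: "\<And>i. i \<in> I \<Longrightarrow> chain_uniform g (- E i)"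
  shows "chain_uniform (removal_bound \<eta> f g) G"
  unfolding chain_uniform_def
proof (intro ballI allI impI)
  fix x y t assume x_in: "x \<in> G" and y_in: "y \<in> G"
    and ratio: "dist x y \<le> t * codist G x" "dist x y \<le> t * codist G y"
  have "0 \<le> t * codist G x" using ratio(1) zero_le_dist[of x y] by linarith
  then have t_nonneg: "0 \<le> t" using codist_G_pos[OF x_in] by (simp add: zero_le_mult_iff)
  let ?c = "detour_cost \<eta>" and ?t = "2*t/\<eta>"
  show "(x, y) \<in> chain_step (1/2) G ^^ removal_bound \<eta> f g t"
  proof (cases "\<exists>i\<in>I. x \<in> ball (a i) (R i) \<and> y \<in> ball (a i) (R i)")
    case True
    then obtain i where in_ball: "i \<in> I" "x \<in> ball (a i) (R i)" "y \<in> ball (a i) (R i)" by blast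
    have "(x, y) \<in> chain_step (1/2) G ^^ (g t * ?c)"
      by (rule chain_inside[OF in_ball(1) chain_E[OF in_ball(1)] _ _ ratio t_nonneg])
        (use x_in y_in in_ball in auto)
    then show ?thesis by (rule chain_pad) (use y_in in \<open>auto simp: removal_bound_def algebra_simps\<close>)
  next
    case False
    obtain u where u_exit: "u \<in> closed_segment x y" "u \<in> outer" "codist G x \<le> 2/\<eta> * codist G u"
      "(x, u) \<in> chain_step (1/2) G ^^ (g ?t * ?c)"
      by (rule escape_hole[OF chain_E x_in _ ratio(1) t_nonneg]) (use False in auto)
    obtain v where v_exit: "v \<in> closed_segment y x" "v \<in> outer" "codist G y \<le> 2/\<eta> * codist G v"
      "(y, v) \<in> chain_step (1/2) G ^^ (g ?t * ?c)"
      by (rule escape_hole[OF chain_E y_in _ ratio(2)[unfolded dist_commute[of x]] t_nonneg])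
        (use False in auto)
    have "dist u v \<le> dist x y"
      using u_exit(1) v_exit(1)
      by (metis dist_commute dist_decreases_closed_segment dist_in_closed_segment order_trans)
    moreover have "t * codist G x \<le> t * (2/\<eta> * codist G u)" "t * codist G y \<le> t * (2/\<eta> * codist G v)"
      using u_exit(3) v_exit(3) t_nonneg by (simp_all only: mult_left_mono)
    ultimately have "dist u v \<le> ?t * codist G u" "dist u v \<le> ?t * codist G v"
      using ratio by (auto simp: mult_ac)
    then have "(u, v) \<in> chain_step (1/2) G ^^ (f ?t * ?c)"
      using u_exit(2) v_exit(2) t_nonneg eta_pos by (intro chain_outside[OF chain_D]) auto
    from relpow_trans[OF relpow_trans[OF u_exit(4) this] chain_sym[OF v_exit(4)]]
    show ?thesis by (rule chain_pad) (use y_in in \<open>auto simp: removal_bound_def algebra_simps\<close>)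
  qed
qed

end

definition puncture_bound :: "(real \<Rightarrow> nat) \<Rightarrow> real \<Rightarrow> nat" where
  "puncture_bound f = removal_bound (1/5) f (\<lambda>t. Suc (nat \<lceil>2 * t\<rceil>) + 32)"

lemma chain_uniform_remove_point:
  fixes b :: "'a::euclidean_space"
  assumes dim: "2 \<le> DIM('a)" and D_props: "open D" "D \<noteq> UNIV" "b \<in> D" and chain_D: "chain_uniform f D"
  shows "chain_uniform (puncture_bound f) (D - {b})"
proof -
  note pos = codist_pos[OF D_props]
  interpret hole_system "1/5" D "{()}" "\<lambda>_. b" "\<lambda>_. codist D b / 4" "\<lambda>_. {b}"
  proof
    show "1/5 * (codist D b / 4) \<le> codist D z" if "z \<in> cball b (codist D b / 4)" for z
      using that codist_triangle[of D b z] pos by simp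
    show "1/5 * codist D z \<le> codist D b / 4" if "z \<in> ball b (codist D b / 4)" for z
      using that codist_triangle[of D z b] by (simp add: dist_commute)
  qed (use dim D_props pos in auto)
  show ?thesis
    unfolding puncture_bound_def
    using chain_uniform_remove_holes[OF chain_D punctured_chain_uniform[OF dim]] by simp
qed

section \<open>Sets accumulating at a point\<close>

locale collapsing_sets =
  fixes D :: "'a::euclidean_space set" and x\<^sub>0 :: 'a and c :: real
    and I :: "'i set" and x :: "'i \<Rightarrow> 'a" and r :: "'i \<Rightarrow> real" and E :: "'i \<Rightarrow> 'a set"
  assumes dim: "2 \<le> DIM('a)" and c_pos: "0 < c" and c_less_1: "c < 1"
    and open_D: "open D" and D_not_UNIV: "D \<noteq> UNIV" and x\<^sub>0_in_D: "x\<^sub>0 \<in> D"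
    and r_pos: "i \<in> I \<Longrightarrow> 0 < r i" and r_le: "i \<in> I \<Longrightarrow> 2 * r i \<le> dist x\<^sub>0 (x i)"
    and near: "i \<in> I \<Longrightarrow> 2 * dist x\<^sub>0 (x i) \<le> codist D x\<^sub>0"
    and apart: "i \<in> I \<Longrightarrow> j \<in> I \<Longrightarrow> i \<noteq> j \<Longrightarrow> r i + r j \<le> dist (x i) (x j)"
    and spread: "i \<in> I \<Longrightarrow> j \<in> I \<Longrightarrow> i \<noteq> j \<Longrightarrow> dist x\<^sub>0 (x i) \<le> 2 * dist (x i) (x j)"
    and closed_E: "i \<in> I \<Longrightarrow> closed (E i)" and E_subset: "i \<in> I \<Longrightarrow> E i \<subseteq> ball (x i) (c * r i)"
    and x_in_E: "i \<in> I \<Longrightarrow> x i \<in> E i"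
begin

definition \<epsilon> :: real where "\<epsilon> = (1 - c) / 8"

text \<open>Adding a fraction of \<open>|x\<^sub>i - x\<^sub>0|\<close> makes the holes comparable to their distance from \<open>x\<^sub>0\<close>,
  however small \<open>r\<^sub>i\<close> is.\<close>

definition hole_radius :: "'i \<Rightarrow> real" where
  "hole_radius i = c * r i + \<epsilon> * dist x\<^sub>0 (x i)"

lemma eps_pos: "0 < \<epsilon>" and c_eq: "c = 1 - 8 * \<epsilon>"
  using c_less_1 unfolding \<epsilon>_def by (auto simp: field_simps)

lemma dist_pos: "i \<in> I \<Longrightarrow> 0 < dist x\<^sub>0 (x i)"
  using r_pos r_le by fastforce

lemma hole_radius_bounds:
  assumes "i \<in> I"
  shows "\<epsilon> * dist x\<^sub>0 (x i) < hole_radius i" "hole_radius i \<le> dist x\<^sub>0 (x i) / 2"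
proof -
  show "\<epsilon> * dist x\<^sub>0 (x i) < hole_radius i"
    using c_pos r_pos[OF assms] unfolding hole_radius_def by simp
  have "c * r i \<le> c * (dist x\<^sub>0 (x i) / 2)" using c_pos r_le[OF assms] by (intro mult_left_mono) auto
  moreover have "\<epsilon> * dist x\<^sub>0 (x i) = (1 - c) / 8 * dist x\<^sub>0 (x i)" unfolding \<epsilon>_def by simp
  moreover have "0 \<le> (1 - c) * dist x\<^sub>0 (x i)" using c_less_1 by simp
  ultimately show "hole_radius i \<le> dist x\<^sub>0 (x i) / 2"
    unfolding hole_radius_def by (simp add: algebra_simps)
qed

lemma hole_radius_pos: "i \<in> I \<Longrightarrow> 0 < hole_radius i"
  using hole_radius_bounds(1) mult_pos_pos[OF eps_pos dist_pos] by (rule order_less_trans[rotated])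

lemma half_eps_hole_radius_le:
  assumes "i \<in> I" shows "\<epsilon> / 2 * hole_radius i \<le> \<epsilon> * dist x\<^sub>0 (x i)"
proof -
  have "hole_radius i \<le> 2 * dist x\<^sub>0 (x i)"
    using hole_radius_bounds(2)[OF assms] dist_pos[OF assms] by linarith
  then have "\<epsilon> / 2 * hole_radius i \<le> \<epsilon> / 2 * (2 * dist x\<^sub>0 (x i))"
    using eps_pos by (intro mult_left_mono) auto
  then show ?thesis by simp
qed

lemma dist_hole_bounds:
  assumes "i \<in> I" "z \<in> cball (x i) (hole_radius i)"
  shows "dist x\<^sub>0 (x i) / 2 \<le> dist x\<^sub>0 z" "dist x\<^sub>0 z \<le> 3/2 * dist x\<^sub>0 (x i)"
  using assms(2) hole_radius_bounds(2)[OF assms(1)]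
    dist_triangle[of x\<^sub>0 "x i" z] dist_triangle[of x\<^sub>0 z "x i"]
  by (auto simp: dist_commute)

lemma holes_separated:
  assumes i_in: "i \<in> I" and j_in: "j \<in> I" and i_ne_j: "i \<noteq> j"
    and z_in: "z \<in> cball (x i) (hole_radius i)" and w_in: "w \<in> cball (x j) (hole_radius j)"
  shows "\<epsilon> / 2 * hole_radius i \<le> dist z w"
proof -
  let ?L = "dist (x i) (x j)"
  have "hole_radius i + hole_radius j = c * (r i + r j) + \<epsilon> * (dist x\<^sub>0 (x i) + dist x\<^sub>0 (x j))"
    unfolding hole_radius_def by (simp add: algebra_simps)
  also have "\<dots> \<le> c * ?L + \<epsilon> * (4 * ?L)"
    using apart[OF i_in j_in i_ne_j] spread[OF i_in j_in i_ne_j]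
      spread[OF j_in i_in i_ne_j[symmetric]] c_pos eps_pos
    by (intro add_mono mult_left_mono) (auto simp: dist_commute)
  also have "\<dots> = (c + 4 * \<epsilon>) * ?L" by (simp add: algebra_simps)
  also have "c + 4 * \<epsilon> = 1 - 4 * \<epsilon>" using c_eq by simp
  finally have "hole_radius i + hole_radius j \<le> (1 - 4 * \<epsilon>) * ?L" .
  moreover have "?L \<le> hole_radius i + dist z w + hole_radius j"
    using z_in w_in dist_triangle[of "x i" "x j" z] dist_triangle[of z "x j" w]
    by (simp add: dist_commute)
  moreover have "\<epsilon> * dist x\<^sub>0 (x i) \<le> 2 * (\<epsilon> * ?L)"
    using mult_left_mono[OF spread[OF i_in j_in i_ne_j], of \<epsilon>] eps_pos by simp
  moreover have "0 \<le> \<epsilon> * ?L" using eps_pos by simp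
  ultimately show ?thesis using half_eps_hole_radius_le[OF i_in] by (simp add: algebra_simps)
qed

lemma hole_depth:
  assumes i_in: "i \<in> I" and z_in: "z \<in> cball (x i) (hole_radius i)"
  shows "hole_radius i \<le> codist (D - {x\<^sub>0}) z"
proof -
  have "dist x\<^sub>0 (x i) / 2 \<le> codist (D - {x\<^sub>0}) z"
  proof (rule codist_ge)
    fix w assume "w \<notin> D - {x\<^sub>0}"
    then consider "w = x\<^sub>0" | "codist D x\<^sub>0 \<le> dist x\<^sub>0 w" using codist_le by blast
    then show "dist x\<^sub>0 (x i) / 2 \<le> dist z w"
      by cases (use dist_hole_bounds[OF i_in z_in] near[OF i_in] dist_triangle[of x\<^sub>0 w z] in
          \<open>auto simp: dist_commute\<close>)
  qed (use D_not_UNIV in auto)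
  then show ?thesis using hole_radius_bounds(2)[OF i_in] by linarith
qed

lemma hole_width:
  assumes i_in: "i \<in> I" and z_in: "z \<in> cball (x i) (hole_radius i)"
  shows "\<epsilon> / 2 * codist (D - {x\<^sub>0}) z \<le> hole_radius i"
proof -
  have "codist (D - {x\<^sub>0}) z \<le> dist x\<^sub>0 z" unfolding dist_commute[of x\<^sub>0] by (rule codist_le) simp
  also have "\<dots> \<le> 2 * dist x\<^sub>0 (x i)"
    using dist_hole_bounds(2)[OF i_in z_in] dist_pos[OF i_in] by linarith
  finally have "\<epsilon> / 2 * codist (D - {x\<^sub>0}) z \<le> \<epsilon> / 2 * (2 * dist x\<^sub>0 (x i))"
    using eps_pos by (intro mult_left_mono) auto
  then show ?thesis using hole_radius_bounds(1)[OF i_in] by simp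
qed

sublocale holes: hole_system "\<epsilon> / 2" "D - {x\<^sub>0}" I x hole_radius E
proof
  show half_eps: "0 < \<epsilon> / 2" "\<epsilon> / 2 \<le> 1" using eps_pos c_eq c_pos by auto
  fix i assume i_in: "i \<in> I"
  show "E i \<noteq> {}" using x_in_E[OF i_in] by blast
  show "dist (x i) w \<le> (1 - \<epsilon> / 2) * hole_radius i" if "w \<in> E i" for w
    using E_subset[OF i_in] that half_eps_hole_radius_le[OF i_in] unfolding hole_radius_def
    by (auto simp: algebra_simps)
  show "\<epsilon> / 2 * hole_radius i \<le> codist (D - {x\<^sub>0}) z" if "z \<in> cball (x i) (hole_radius i)" for z
  proof -
    have "\<epsilon> / 2 * hole_radius i \<le> 1 * hole_radius i"
      using hole_radius_pos[OF i_in] by (intro mult_right_mono half_eps) simp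
    then show ?thesis using hole_depth[OF i_in that] by linarith
  qed
qed (use dim open_D D_not_UNIV closed_E hole_radius_pos hole_width holes_separated in auto)

lemma remainder_eq: "D - ((\<Union>i\<in>I. E i) \<union> {x\<^sub>0}) = holes.G"
  by blast

lemma open_remainder: "open (D - ((\<Union>i\<in>I. E i) \<union> {x\<^sub>0}))"
  unfolding remainder_eq by (rule holes.open_G)

lemma remainder_nonempty: "I \<noteq> {} \<Longrightarrow> D - ((\<Union>i\<in>I. E i) \<union> {x\<^sub>0}) \<noteq> {}"
  unfolding remainder_eq by (rule holes.G_nonempty)

theorem chain_uniform_remainder:
  assumes "chain_uniform f D" and "\<And>i. i \<in> I \<Longrightarrow> chain_uniform g (- E i)"
  shows "chain_uniform (removal_bound ((1 - c) / 16) (puncture_bound f) g) (D - ((\<Union>i\<in>I. E i) \<union> {x\<^sub>0}))"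
proof -
  have "chain_uniform (puncture_bound f) (D - {x\<^sub>0})"
    using dim open_D D_not_UNIV x\<^sub>0_in_D assms(1) by (rule chain_uniform_remove_point)
  from holes.chain_uniform_remove_holes[OF this assms(2)] show ?thesis
    unfolding remainder_eq \<epsilon>_def by simp
qed

end

lemma add_radii_le_dist:
  fixes x y :: "'a::real_normed_vector"
  assumes disjoint: "ball x r \<inter> ball y s = {}" and radii_pos: "0 < r" "0 < s"
  shows "r + s \<le> dist x y"
proof (rule ccontr)
  assume "\<not> ?thesis"
  then have close: "dist x y / (r + s) < 1" using radii_pos by (simp add: pos_divide_less_eq)
  define z where "z = x + (r / (r + s)) *\<^sub>R (y - x)"
  have "dist x z = r * (dist x y / (r + s))"
    unfolding z_def using radii_pos by (simp add: dist_norm norm_minus_commute)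
  then have "dist x z < r" using mult_strict_left_mono[OF close radii_pos(1)] by simp
  have weights: "s / (r + s) = 1 - r / (r + s)" using radii_pos by (simp add: field_simps)
  have "y - z = (s / (r + s)) *\<^sub>R (y - x)" unfolding z_def weights by (simp add: algebra_simps)
  then have "dist y z = s * (dist x y / (r + s))"
    using radii_pos by (simp add: dist_norm norm_minus_commute)
  then have "dist y z < s" using mult_strict_left_mono[OF close radii_pos(2)] by simp
  then show False using disjoint \<open>dist x z < r\<close> by (auto simp: disjoint_iff)
qed

lemma halving_sequence_collapsing:
  fixes x :: "nat \<Rightarrow> 'a::euclidean_space"
  assumes dim: "2 \<le> DIM('a)" and c_bounds: "0 < c" "c < 1" and D_props: "open D" "D \<noteq> UNIV" "x\<^sub>0 \<in> D"
    and segment: "\<And>i. 2 \<le> i \<Longrightarrow> x i \<in> closed_segment x\<^sub>0 (x (i - 1))"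
    and dist: "\<And>i. 1 \<le> i \<Longrightarrow> dist x\<^sub>0 (x i) = codist D x\<^sub>0 / 2 ^ (i + 2)"
    and r_pos: "\<And>i. 1 \<le> i \<Longrightarrow> 0 < r i" and disjoint: "disjoint_family_on (\<lambda>i. ball (x i) (r i)) {1..}"
    and E_props: "\<And>i. 1 \<le> i \<Longrightarrow> closed (E i) \<and> E i \<subseteq> ball (x i) (c * r i) \<and> x i \<in> E i"
  shows "collapsing_sets D x\<^sub>0 c {1..} x r E"
proof
  have apart: "r i + r j \<le> dist (x i) (x j)" if "1 \<le> i" "1 \<le> j" "i \<noteq> j" for i j
    by (rule add_radii_le_dist) (use disjoint r_pos that in \<open>auto simp: disjoint_family_on_def\<close>)
  then show "r i + r j \<le> dist (x i) (x j)" if "i \<in> {1..}" "j \<in> {1..}" "i \<noteq> j" for i j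
    using that by simp
  have pos: "0 < codist D x\<^sub>0" by (rule codist_pos[OF D_props])
  have halved: "2 * dist x\<^sub>0 (x j) \<le> dist x\<^sub>0 (x i)" if "1 \<le> i" "i < j" for i j
  proof -
    have "(2::real) ^ (Suc i + 2) \<le> 2 ^ (j + 2)" using that by (intro power_increasing) auto
    then have "codist D x\<^sub>0 / 2 ^ (j + 2) \<le> codist D x\<^sub>0 / 2 ^ (Suc i + 2)"
      using pos by (intro divide_left_mono) auto
    then show ?thesis using dist[of i] dist[of j] that by simp
  qed
  show "dist x\<^sub>0 (x i) \<le> 2 * dist (x i) (x j)" if "i \<in> {1..}" "j \<in> {1..}" "i \<noteq> j" for i j
    using halved[of i j] halved[of j i] that
      dist_triangle[of x\<^sub>0 "x i" "x j"] dist_triangle[of x\<^sub>0 "x j" "x i"]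
    by (cases "i < j") (auto simp: dist_commute)
  fix i :: nat assume "i \<in> {1..}"
  then have i_ge: "1 \<le> i" by simp
  have "(2::real) ^ 1 \<le> 2 ^ (i + 2)" by (intro power_increasing) auto
  then have "codist D x\<^sub>0 / 2 ^ (i + 2) \<le> codist D x\<^sub>0 / 2 ^ 1"
    using pos by (intro divide_left_mono) auto
  then show "2 * dist x\<^sub>0 (x i) \<le> codist D x\<^sub>0" using dist[OF i_ge] by simp
  have "x (Suc i) \<in> closed_segment x\<^sub>0 (x i)" using segment[of "Suc i"] i_ge by simp
  then have "dist x\<^sub>0 (x i) = dist x\<^sub>0 (x (Suc i)) + dist (x (Suc i)) (x i)"
    using between between_mem_segment by metis
  moreover have "2 * dist x\<^sub>0 (x (Suc i)) = dist x\<^sub>0 (x i)"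
    using dist[OF i_ge] dist[of "Suc i"] by simp
  ultimately show "2 * r i \<le> dist x\<^sub>0 (x i)"
    using apart[of i "Suc i"] r_pos[of "Suc i"] i_ge by (simp add: dist_commute)
qed (use dim c_bounds D_props r_pos E_props in auto)

theorem theorem4p23:
  fixes \<phi> \<psi> :: "real \<Rightarrow> real" and c :: real
  assumes "CARD('n::finite) \<ge> 2"
    and "halfline_homeo \<phi>" and "halfline_homeo \<psi>"
    and "0 < c" and "c < 1"
  shows "\<exists>\<phi>\<^sub>3. halfline_homeo \<phi>\<^sub>3 \<and>
    (\<forall>(D :: (real ^ 'n) set) (x\<^sub>0 :: real ^ 'n) (x :: nat \<Rightarrow> real ^ 'n) (r :: nat \<Rightarrow> real)
        (E :: nat \<Rightarrow> (real ^ 'n) set).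
       uniform_domain \<phi> D \<and> x\<^sub>0 \<in> D \<and>
       (\<forall>i\<ge>1. x i \<in> ball x\<^sub>0 (bdist D x\<^sub>0)) \<and>
       (\<forall>i\<ge>2. x i \<in> half_open_segment x\<^sub>0 (x (i - 1))) \<and>
       (\<forall>i\<ge>1. dist x\<^sub>0 (x i) = 1 / 2 ^ (i + 2) * bdist D x\<^sub>0) \<and>
       (\<forall>i\<ge>1. 0 < r i) \<and>
       disjoint_family_on (\<lambda>i. ball (x i) (r i)) {1..} \<and>
       (\<forall>i\<ge>1. closed (E i) \<and> E i \<subseteq> ball (x i) (c * r i) \<and>
          uniform_domain \<psi> (- E i) \<and> x i \<in> E i)
       \<longrightarrow> uniform_domain \<phi>\<^sub>3 (D - ((\<Union>i\<in>{1..}. E i) \<union> {x\<^sub>0})))"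
proof -
  obtain f where f_chain: "\<And>G :: (real ^ 'n) set. uniform_domain \<phi> G \<Longrightarrow> chain_uniform f G"
    using uniform_imp_chain_uniform[OF assms(2)] by blast
  obtain g where g_chain: "\<And>G :: (real ^ 'n) set. uniform_domain \<psi> G \<Longrightarrow> chain_uniform g G"
    using uniform_imp_chain_uniform[OF assms(3)] by blast
  obtain \<phi>\<^sub>3 where majorant: "halfline_homeo \<phi>\<^sub>3"
    "\<And>G :: (real ^ 'n) set. open G \<Longrightarrow> G \<noteq> {} \<Longrightarrow> G \<noteq> UNIV \<Longrightarrow>
      chain_uniform (removal_bound ((1 - c) / 16) (puncture_bound f) g) G \<Longrightarrow> uniform_domain \<phi>\<^sub>3 G"
    using chain_uniform_imp_uniform by blast
  show ?thesis
  proof (intro exI[of _ \<phi>\<^sub>3] conjI allI impI majorant(1); elim conjE)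
    fix D :: "(real ^ 'n) set" and x\<^sub>0 x r E
    assume uniform: "uniform_domain \<phi> D" and "x\<^sub>0 \<in> D"
      and "\<forall>i\<ge>2. x i \<in> half_open_segment x\<^sub>0 (x (i - 1))"
        "\<forall>i\<ge>1. dist x\<^sub>0 (x i) = 1 / 2 ^ (i + 2) * bdist D x\<^sub>0"
        "\<forall>i\<ge>1. 0 < r i" "disjoint_family_on (\<lambda>i. ball (x i) (r i)) {1..}"
      and E_props: "\<forall>i\<ge>1. closed (E i) \<and> E i \<subseteq> ball (x i) (c * r i) \<and> uniform_domain \<psi> (- E i) \<and> x i \<in> E i"
    moreover have "open D" "D \<noteq> UNIV" using uniform unfolding uniform_domain_def domain_def by auto
    ultimately interpret collapsing_sets D x\<^sub>0 c "{1..}" x r E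
      using assms(1,4,5)
      by (intro halving_sequence_collapsing) (auto simp: half_open_segment_def bdist_eq_codist)
    show "uniform_domain \<phi>\<^sub>3 (D - ((\<Union>i\<in>{1..}. E i) \<union> {x\<^sub>0}))"
      using f_chain[OF uniform] g_chain E_props open_remainder remainder_nonempty
      by (intro majorant(2) chain_uniform_remainder) auto
  qed
qed

end
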